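(* There exists an absolute constant $c>0$ and an infinite family of $k$-unicast instances whose coding gap for the $\ell_p$ norm of completion times is at least $\Omega(\log^{c} k)$.
   Context: A $k$-unicast instance $\mathcal{M}=(G,\mathcal{S})$ consists of a connected undirected graph $G=(V,E)$ with integer capacities $c_e\ge1$ and sessions $\{(s_i,t_i,d_i)\}_{i=1}^k$ with $d_i\in\mathbb{Z}_{\ge1}$ sub-packets to be sent from $s_i$ to $t_i$. Protocols run in synchronous rounds; in each round each node sends along each incident edge $e$ a message of at most $c_e$ sub-packets that is a predetermined function of what it has received earlier and its own source packets. Network coding protocols allow arbitrary functions; routing protocols only forward sub-packets already received or originating at the node. A protocol has completion times $(T_1,\dots,T_k)$ if after $T_i$ rounds $t_i$ can determine $s_i$'s packet. The coding gap for the $\ell_p$ norm is the ratio of the smallest $\ell_p$ norm of the completion-time vector of any routing protocol to the smallest such value of any network coding protocol. *)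

theory Defs
  imports
    "HOL-Analysis.Analysis"
    "HOL-Library.Landau_Symbols"
    "Graph_Theory.Graph_Theory"
begin

section \<open>Multiple-unicast instances\<close>

text \<open>
  An undirected graph is a symmetric, loop-free digraph (locale \<^locale>\<open>pair_graph\<close>), so every
  undirected edge {u, v} is present as the two arcs (u, v) and (v, u).  Capacities are attached to
  the undirected edge {u, v} and bound the message sent over it by each of its endpoints.
\<close>

record 'v unicast_instance =
  network :: "'v pair_pre_digraph"
  capacity :: "'v set \<Rightarrow> nat"
  sessions :: "('v \<times> 'v \<times> nat) list"

definition num_sessions :: "'v unicast_instance \<Rightarrow> nat" where
  "num_sessions M = length (sessions M)"

definition source :: "'v unicast_instance \<Rightarrow> nat \<Rightarrow> 'v" where
  "source M i = fst (sessions M ! i)"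

definition sink :: "'v unicast_instance \<Rightarrow> nat \<Rightarrow> 'v" where
  "sink M i = fst (snd (sessions M ! i))"

definition demand :: "'v unicast_instance \<Rightarrow> nat \<Rightarrow> nat" where
  "demand M i = snd (snd (sessions M ! i))"

definition multiple_unicast :: "'v unicast_instance \<Rightarrow> bool" where
  "multiple_unicast M \<longleftrightarrow>
     pair_graph (network M) \<and>
     Digraph_Component.connected (with_proj (network M)) \<and>
     (\<forall>(u, v) \<in> parcs (network M). capacity M {u, v} \<ge> 1) \<and>
     num_sessions M \<ge> 1 \<and>
     (\<forall>i < num_sessions M. source M i \<in> pverts (network M) \<and>
        sink M i \<in> pverts (network M) \<and> demand M i \<ge> 1)"


section \<open>Protocols\<close>

text \<open>
  Sub-packets are symbols of a finite alphabet {0, ..., q - 1}; the size q \<ge> 2 (that is, the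
  uniform sub-packet size) is part of the protocol.  An input lists the packet of every session.
\<close>

definition inputs :: "'v unicast_instance \<Rightarrow> nat \<Rightarrow> nat list list set" where
  "inputs M q = {w. length w = num_sessions M \<and>
     (\<forall>i < num_sessions M. length (w ! i) = demand M i \<and> set (w ! i) \<subseteq> {..<q})}"

text \<open>
  What a node knows: its own source packets by session number (the empty list for a session that
  does not originate at the node; packets themselves are nonempty), and for every completed round
  the messages received from the individual neighbours.
\<close>

type_synonym 'v knowledge = "(nat \<Rightarrow> nat list) \<times> ('v \<Rightarrow> nat list) list"

text \<open>
  \<open>send P r (u, v) K\<close> is the message that u, knowing K, sends to v in round r.  Rounds are numbered
  from 0, so that K contains the messages of r rounds.
\<close>

record 'v protocol =
  alphabet_size :: nat
  send :: "nat \<Rightarrow> 'v \<times> 'v \<Rightarrow> 'v knowledge \<Rightarrow> nat list"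

text \<open>A history lists, round by round, the messages on all arcs.\<close>

definition knowledge ::
    "'v unicast_instance \<Rightarrow> nat list list \<Rightarrow> 'v \<Rightarrow> ('v \<times> 'v \<Rightarrow> nat list) list \<Rightarrow> 'v knowledge" where
  "knowledge M w u h =
     ((\<lambda>i. if i < num_sessions M \<and> source M i = u then w ! i else []),
      map (\<lambda>m v. m (v, u)) h)"

primrec history ::
    "'v unicast_instance \<Rightarrow> 'v protocol \<Rightarrow> nat list list \<Rightarrow> nat \<Rightarrow> ('v \<times> 'v \<Rightarrow> nat list) list" where
  "history M P w 0 = []"
| "history M P w (Suc r) = history M P w r @
     [\<lambda>e. if e \<in> parcs (network M)
          then send P r e (knowledge M w (fst e) (history M P w r)) else []]"

definition message ::
    "'v unicast_instance \<Rightarrow> 'v protocol \<Rightarrow> nat list list \<Rightarrow> nat \<Rightarrow> 'v \<times> 'v \<Rightarrow> nat list" where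
  "message M P w r e = (history M P w (Suc r) ! r) e"

text \<open>
  The number n of sub-packets sent over an arc in a given round is predetermined, i.e. independent
  of the input: otherwise the length of a message would carry information beyond its at most
  \<open>capacity M {u, v}\<close> sub-packets.
\<close>

definition coding_protocol :: "'v unicast_instance \<Rightarrow> 'v protocol \<Rightarrow> bool" where
  "coding_protocol M P \<longleftrightarrow> alphabet_size P \<ge> 2 \<and>
     (\<forall>r. \<forall>(u, v) \<in> parcs (network M). \<exists>n \<le> capacity M {u, v}.
        \<forall>w \<in> inputs M (alphabet_size P).
          length (message M P w r (u, v)) = n \<and>
          set (message M P w r (u, v)) \<subseteq> {..<alphabet_size P})"

text \<open>
  In a routing protocol the messages are copies of sub-packets.  The pair (i, j) names the
  j-th sub-packet of session i, and a forwarding schedule prescribes, independently of the contents,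
  which sub-packets are sent over an arc in a round.  \<open>held M \<sigma> r u\<close> is the set of sub-packets
  that originate at u or were forwarded to u in the first r rounds.
\<close>

definition held ::
    "'v unicast_instance \<Rightarrow> (nat \<Rightarrow> 'v \<times> 'v \<Rightarrow> (nat \<times> nat) list) \<Rightarrow> nat \<Rightarrow> 'v \<Rightarrow> (nat \<times> nat) set" where
  "held M \<sigma> r u =
     {(i, j). i < num_sessions M \<and> j < demand M i \<and> source M i = u} \<union>
     (\<Union>r' \<in> {..<r}. \<Union>v \<in> {v. (v, u) \<in> parcs (network M)}. set (\<sigma> r' (v, u)))"

definition routing_protocol :: "'v unicast_instance \<Rightarrow> 'v protocol \<Rightarrow> bool" where
  "routing_protocol M P \<longleftrightarrow> coding_protocol M P \<and>
     (\<exists>\<sigma>. \<forall>r. \<forall>(u, v) \<in> parcs (network M).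
        set (\<sigma> r (u, v)) \<subseteq> held M \<sigma> r u \<and>
        (\<forall>w \<in> inputs M (alphabet_size P).
           message M P w r (u, v) = map (\<lambda>(i, j). w ! i ! j) (\<sigma> r (u, v))))"

definition has_completion_times ::
    "'v unicast_instance \<Rightarrow> 'v protocol \<Rightarrow> nat list \<Rightarrow> bool" where
  "has_completion_times M P T \<longleftrightarrow> length T = num_sessions M \<and>
     (\<forall>i < num_sessions M. \<exists>decode. \<forall>w \<in> inputs M (alphabet_size P).
        decode (knowledge M w (sink M i) (history M P w (T ! i))) = w ! i)"


section \<open>Coding gaps\<close>

definition lp_norm :: "ereal \<Rightarrow> nat list \<Rightarrow> real" where
  "lp_norm p T =
     (if p = \<infinity> then Max (real ` set T)
      else (\<Sum>t\<leftarrow>T. real t powr real_of_ereal p) powr (1 / real_of_ereal p))"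

text \<open>
  For the norms in question the infima below are minima: completion times are natural numbers, and
  only finitely many vectors of a given length lie below a given norm.
\<close>

definition best_coding :: "ereal \<Rightarrow> 'v unicast_instance \<Rightarrow> real" where
  "best_coding p M =
     Inf {lp_norm p T | T P. coding_protocol M P \<and> has_completion_times M P T}"

definition best_routing :: "ereal \<Rightarrow> 'v unicast_instance \<Rightarrow> real" where
  "best_routing p M =
     Inf {lp_norm p T | T P. routing_protocol M P \<and> has_completion_times M P T}"

definition coding_gap :: "ereal \<Rightarrow> 'v unicast_instance \<Rightarrow> real" where
  "coding_gap p M = best_routing p M / best_coding p M"

end

theory Submission
  imports Defs "HOL-Number_Theory.Cong"
begin

text \<open>
  The basic gadget has terminals s_0, ..., s_n and t_0, ..., t_n, an edge from s_p to t_q for all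
  p \<noteq> q, and one bottleneck edge between t_0 and s_0.  With coding, t_0 receives all the symbols
  and sends their sum over the bottleneck; t_i obtains the sum from s_0 and all the other
  summands directly, so that two steps suffice for all sessions (s_i, t_i).  Without the bottleneck,
  s_i and t_i are at distance 3, and the bottleneck carries few routed symbols.

  Every edge of a gadget other than the bottleneck is now implemented as a session of a gadget of the next
  depth, down to depth h.  This multiplies the coding time by about 2 and the distance by 3 per
  level.  The gadgets of one depth are indexed by the vertices of a graph of girth greater than 3^h whose
  edges are coloured by the edges of the gadgets, so that short walks cannot exploit the fact that
  a gadget serves many others: the word of colours along a short closed walk cancels, and the distance bound
  follows by induction on the cancellation.  The number of gadgets of each depth is the same, hence
  there are only h bottlenecks per gadget of depth 0, which has at least 4 h 3^h sessions, so that at most half of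
  the sessions can be routed over a bottleneck within 3^h rounds.  A suitable graph is the Cayley graph
  of involutory 2 x 2 matrices over the integers modulo a large number; the number of its vertices
  is exponential in a power of 3^h, whence a gap of (3/2)^h is polylogarithmic.
\<close>

section \<open>Protocols as families of messages\<close>

text \<open>A protocol seen from outside: \<open>f r e w\<close> is the message as a function of the
  whole input. That the sender can compute it is demanded separately, which spares writing
  \<open>send\<close> functions.\<close>

definition sent_upto ::
    "'v unicast_instance \<Rightarrow> (nat \<Rightarrow> 'v \<times> 'v \<Rightarrow> nat list list \<Rightarrow> nat list) \<Rightarrow> nat list list \<Rightarrow> nat \<Rightarrow>
     ('v \<times> 'v \<Rightarrow> nat list) list" where
  "sent_upto M f w r = map (\<lambda>r' e. if e \<in> parcs (network M) then f r' e w else []) [0..<r]"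

lemma sent_upto_Suc:
  "sent_upto M f w (Suc r) =
     sent_upto M f w r @ [\<lambda>e. if e \<in> parcs (network M) then f r e w else []]"
  by (simp add: sent_upto_def)

lemma knowledge_sent_upto_eqD:
  assumes "knowledge M w u (sent_upto M f w r) = knowledge M w' u (sent_upto M f w' r)"
  shows "i < num_sessions M \<Longrightarrow> source M i = u \<Longrightarrow> w ! i = w' ! i"
    and "r' < r \<Longrightarrow> (v, u) \<in> parcs (network M) \<Longrightarrow> f r' (v, u) w = f r' (v, u) w'"
proof -
  show "w ! i = w' ! i" if "i < num_sessions M" "source M i = u"
    using fun_cong[OF arg_cong[OF assms, of fst], of i] that by (simp add: knowledge_def)
  have "\<forall>r'\<in>{0..<r}. \<forall>v. (if (v, u) \<in> parcs (network M) then f r' (v, u) w else []) =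
      (if (v, u) \<in> parcs (network M) then f r' (v, u) w' else [])"
    using assms by (simp add: knowledge_def sent_upto_def fun_eq_iff)
  then show "f r' (v, u) w = f r' (v, u) w'" if "r' < r" "(v, u) \<in> parcs (network M)"
    using that by (auto dest!: bspec[of _ _ r'] spec[of _ v])
qed

lemma knowledge_sent_upto_eqI:
  assumes "\<And>i. i < num_sessions M \<Longrightarrow> source M i = u \<Longrightarrow> w ! i = w' ! i"
    and "\<And>r' v. r' < r \<Longrightarrow> (v, u) \<in> parcs (network M) \<Longrightarrow> f r' (v, u) w = f r' (v, u) w'"
  shows "knowledge M w u (sent_upto M f w r) = knowledge M w' u (sent_upto M f w' r)"
  using assms by (auto simp: knowledge_def sent_upto_def fun_eq_iff)

text \<open>Locality suffices for an actual protocol: the sender picks any input compatible with its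
  knowledge and sends what \<open>f\<close> prescribes for it; \<open>det\<close> makes the pick
  irrelevant.\<close>

lemma protocol_of_messages:
  fixes M :: "'v unicast_instance"
  assumes det: "\<And>r u v w w'. (u, v) \<in> parcs (network M) \<Longrightarrow> w \<in> inputs M q \<Longrightarrow> w' \<in> inputs M q \<Longrightarrow>
      knowledge M w u (sent_upto M f w r) = knowledge M w' u (sent_upto M f w' r) \<Longrightarrow>
      f r (u, v) w = f r (u, v) w'"
  obtains P where "alphabet_size P = q"
    "\<And>w r. w \<in> inputs M q \<Longrightarrow> history M P w r = sent_upto M f w r"
    "\<And>w r e. w \<in> inputs M q \<Longrightarrow> e \<in> parcs (network M) \<Longrightarrow> message M P w r e = f r e w"
proof -
  define P where "P = \<lparr>alphabet_size = q,
    send = (\<lambda>r e K. f r e (SOME w. w \<in> inputs M q \<and>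
       knowledge M w (fst e) (sent_upto M f w r) = K))\<rparr>"
  have hist: "history M P w r = sent_upto M f w r" if w: "w \<in> inputs M q" for w r
  proof (induction r)
    case 0
    then show ?case by (simp add: sent_upto_def)
  next
    case (Suc r)
    have "send P r e (knowledge M w (fst e) (sent_upto M f w r)) = f r e w"
      if e: "e \<in> parcs (network M)" for e
    proof -
      obtain u v where uv: "e = (u, v)" by fastforce
      define w' where "w' = (SOME w'. w' \<in> inputs M q \<and>
        knowledge M w' u (sent_upto M f w' r) = knowledge M w u (sent_upto M f w r))"
      have "w' \<in> inputs M q \<and> knowledge M w' u (sent_upto M f w' r) = knowledge M w u (sent_upto M f w r)"
        unfolding w'_def by (rule someI[of _ w]) (use w in auto)
      then have "f r (u, v) w' = f r (u, v) w" using e uv w by (intro det) auto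
      then show ?thesis by (simp add: P_def uv w'_def)
    qed
    then show ?case by (auto simp: Suc sent_upto_Suc fun_eq_iff)
  qed
  show ?thesis
  proof (rule that[of P])
    fix w r e assume *: "w \<in> inputs M q" "e \<in> parcs (network M)"
    show "message M P w r e = f r e w"
      using * unfolding message_def hist[OF *(1)] by (simp add: sent_upto_Suc nth_append)
        (simp add: sent_upto_def)
  qed (simp_all add: P_def[THEN arg_cong, of alphabet_size] hist)
qed

section \<open>Sub-packets held by the nodes under routing\<close>

lemma held_Suc:
  "held M \<sigma> (Suc r) u = held M \<sigma> r u \<union> (\<Union>v \<in> {v. (v, u) \<in> parcs (network M)}. set (\<sigma> r (v, u)))"
  by (auto simp: held_def less_Suc_eq)

lemma held_mono: "r \<le> r' \<Longrightarrow> held M \<sigma> r u \<subseteq> held M \<sigma> r' u"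
  unfolding held_def by (force dest: order_less_le_trans)

lemma held_valid:
  assumes "\<And>r u v. (u, v) \<in> parcs (network M) \<Longrightarrow> set (\<sigma> r (u, v)) \<subseteq> held M \<sigma> r u"
    and "(i, j) \<in> held M \<sigma> r u"
  shows "i < num_sessions M \<and> j < demand M i"
  using assms(2)
proof (induction r arbitrary: u)
  case 0
  then show ?case by (auto simp: held_def)
next
  case (Suc r)
  then show ?case using assms(1) by (fastforce simp: held_Suc)
qed

text \<open>Under a forwarding schedule all that a node sees are copies of held sub-packets, so
  inputs agreeing on these look alike. \<open>held_determined\<close> is the converse.\<close>

lemma knowledge_cong_held:
  assumes \<sigma>: "\<And>r u v. (u, v) \<in> parcs (network M) \<Longrightarrow> set (\<sigma> r (u, v)) \<subseteq> held M \<sigma> r u"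
    and f: "\<And>r u v. (u, v) \<in> parcs (network M) \<Longrightarrow>
        f r (u, v) w = map (\<lambda>(i, j). w ! i ! j) (\<sigma> r (u, v)) \<and>
        f r (u, v) w' = map (\<lambda>(i, j). w' ! i ! j) (\<sigma> r (u, v))"
    and w: "\<And>i j. (i, j) \<in> held M \<sigma> r u \<Longrightarrow> w ! i ! j = w' ! i ! j"
      "w \<in> inputs M q" "w' \<in> inputs M q"
  shows "knowledge M w u (sent_upto M f w r) = knowledge M w' u (sent_upto M f w' r)"
proof (rule knowledge_sent_upto_eqI)
  fix i assume i: "i < num_sessions M" "source M i = u"
  have "length (w ! i) = demand M i" "length (w' ! i) = demand M i"
    using w i by (auto simp: inputs_def)
  moreover have "w ! i ! j = w' ! i ! j" if "j < demand M i" for j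
    using i that by (intro w(1)) (auto simp: held_def)
  ultimately show "w ! i = w' ! i" by (auto simp: list_eq_iff_nth_eq)
next
  fix r' v assume r': "r' < r" "(v, u) \<in> parcs (network M)"
  have "w ! fst x ! snd x = w' ! fst x ! snd x" if "x \<in> set (\<sigma> r' (v, u))" for x
    using that r' by (intro w(1)) (auto simp: held_def)
  then show "f r' (v, u) w = f r' (v, u) w'" using f[OF r'(2)] by (auto simp: case_prod_beta)
qed

lemma history_eq_sent_upto:
  "history M P w r = sent_upto M (\<lambda>r e w. message M P w r e) w r"
proof (induction r)
  case (Suc r)
  have "history M P w (Suc r) ! r = (\<lambda>e. if e \<in> parcs (network M) then message M P w r e else [])"
  proof -
    have "length (history M P w r) = r" for r by (induction r) auto
    then show ?thesis by (auto simp: fun_eq_iff message_def nth_append)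
  qed
  moreover have "length (history M P w r) = r" by (simp add: Suc sent_upto_def)
  ultimately show ?case using Suc by (simp add: sent_upto_Suc nth_append)
qed (simp add: sent_upto_def)

text \<open>Flip one symbol: a sink that does not hold it cannot tell the two inputs apart.\<close>

lemma routing_completion_held:
  assumes \<sigma>: "\<And>r u v. (u, v) \<in> parcs (network M) \<Longrightarrow> set (\<sigma> r (u, v)) \<subseteq> held M \<sigma> r u"
    and msg: "\<And>r u v w. (u, v) \<in> parcs (network M) \<Longrightarrow> w \<in> inputs M (alphabet_size P) \<Longrightarrow>
        message M P w r (u, v) = map (\<lambda>(i, j). w ! i ! j) (\<sigma> r (u, v))"
    and q: "alphabet_size P \<ge> 2"
    and T: "has_completion_times M P T" and i: "i < num_sessions M" "j < demand M i"
  shows "(i, j) \<in> held M \<sigma> (T ! i) (sink M i)"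
proof (rule ccontr)
  assume not: "(i, j) \<notin> held M \<sigma> (T ! i) (sink M i)"
  define w where "w = map (\<lambda>i. replicate (demand M i) (0::nat)) [0..<num_sessions M]"
  define w' where "w' = w[i := (w ! i)[j := 1]]"
  have w: "w \<in> inputs M (alphabet_size P)" using q by (auto simp: inputs_def w_def)
  have w': "w' \<in> inputs M (alphabet_size P)"
    using q i by (auto simp: inputs_def w_def w'_def nth_list_update dest!: set_update_subset_insert[THEN subsetD])
  have "knowledge M w (sink M i) (history M P w (T ! i)) = knowledge M w' (sink M i) (history M P w' (T ! i))"
    unfolding history_eq_sent_upto
  proof (rule knowledge_cong_held[OF \<sigma> _ _ w w'])
    fix i' j' assume h: "(i', j') \<in> held M \<sigma> (T ! i) (sink M i)"
    then have "i' \<noteq> i \<or> j' \<noteq> j" using not by auto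
    then show "w ! i' ! j' = w' ! i' ! j'"
      using held_valid[OF \<sigma> h] by (auto simp: w_def w'_def nth_list_update i)
  qed (use msg w w' in auto)
  moreover obtain dec where "\<forall>w\<in>inputs M (alphabet_size P).
      dec (knowledge M w (sink M i) (history M P w (T ! i))) = w ! i"
    using T i unfolding has_completion_times_def by blast
  ultimately have "w ! i = w' ! i" using w w' by metis
  then have "w ! i ! j = w' ! i ! j" by simp
  then show False using i by (auto simp: w'_def w_def)
qed

text \<open>With no round completed, the sink knows nothing of a packet that originates elsewhere.
  This keeps \<open>best_coding\<close> away from 0, so that the gap is a genuine quotient.\<close>

lemma coding_completion_pos:
  assumes "coding_protocol M P" "has_completion_times M P T" "i < num_sessions M"
    "source M i \<noteq> sink M i" "demand M i \<ge> 1"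
  shows "T ! i \<ge> 1"
proof (rule ccontr)
  assume "\<not> T ! i \<ge> 1"
  then have T0: "T ! i = 0" by simp
  have q: "alphabet_size P \<ge> 2" using assms by (auto simp: coding_protocol_def)
  define w where "w a = map (\<lambda>i'. replicate (demand M i') (if i' = i then a else 0)) [0..<num_sessions M]"
    for a :: nat
  have w: "w a \<in> inputs M (alphabet_size P)" if "a < 2" for a
    using q that by (auto simp: inputs_def w_def)
  have "knowledge M (w 0) (sink M i) [] = knowledge M (w 1) (sink M i) []"
    using assms(4) by (auto simp: knowledge_def w_def fun_eq_iff)
  moreover obtain dec where "\<forall>w\<in>inputs M (alphabet_size P).
      dec (knowledge M w (sink M i) []) = w ! i"
    using assms(2,3) T0 unfolding has_completion_times_def by (metis history.simps(1))
  ultimately have "w 0 ! i = w 1 ! i" using w[of 0] w[of 1] by (metis one_less_numeral_iff semiring_norm(76) zero_less_numeral)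
  then show False using assms(3,5) by (simp add: w_def)
qed

text \<open>Following a sub-packet back through the rounds traces a walk from its source with at
  most one arc per round; if it avoided \<open>B\<close> throughout, it would contradict the
  assumption on walks.\<close>

lemma held_crosses:
  assumes \<sigma>: "\<And>r u v. (u, v) \<in> parcs (network M) \<Longrightarrow> set (\<sigma> r (u, v)) \<subseteq> held M \<sigma> r u"
    and "(i, j) \<in> held M \<sigma> r u"
    and "\<And>n. n \<le> r \<Longrightarrow> (source M i, u) \<notin> (parcs (network M) - B) ^^ n"
  shows "\<exists>r'<r. \<exists>e\<in>B \<inter> parcs (network M). (i, j) \<in> set (\<sigma> r' e)"
  using assms(2,3)
proof (induction r arbitrary: u)
  case 0
  then show ?case by (auto simp: held_def dest!: spec[of _ 0])
next
  case (Suc r)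
  consider "(i, j) \<in> held M \<sigma> r u" | v where "(v, u) \<in> parcs (network M)" "(i, j) \<in> set (\<sigma> r (v, u))"
    using Suc.prems(1) by (auto simp: held_Suc)
  then show ?case
  proof cases
    case 1
    then show ?thesis using Suc.IH[OF 1] Suc.prems(2) by (meson le_SucI less_SucI)
  next
    case 2
    show ?thesis
    proof (cases "(v, u) \<in> B")
      case True
      then show ?thesis using 2 by blast
    next
      case False
      then have e: "(v, u) \<in> parcs (network M) - B" using 2 by auto
      have "(source M i, v) \<notin> (parcs (network M) - B) ^^ n" if "n \<le> r" for n
        using Suc.prems(2)[of "Suc n"] e that by auto
      moreover have "(i, j) \<in> held M \<sigma> r v" using \<sigma> 2 by blast
      ultimately show ?thesis using Suc.IH[of v] by (meson less_SucI)
    qed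
  qed
qed

text \<open>A session with completion time below \<open>L\<close> has its sub-packet 0 carried over
  an arc of \<open>B\<close> in some round below \<open>L\<close>. At unit capacity a round and an
  arc determine the sub-packet, so this assignment is injective.\<close>

lemma routing_slow_sessions:
  assumes M: "multiple_unicast M" and cap: "\<And>e. capacity M e = 1"
    and P: "routing_protocol M P" "has_completion_times M P T"
    and dist: "\<And>i n. i < num_sessions M \<Longrightarrow> n < L \<Longrightarrow> (source M i, sink M i) \<notin> (parcs (network M) - B) ^^ n"
    and B: "finite B"
  shows "card {i. i < num_sessions M \<and> T ! i < L} \<le> L * card B"
proof -
  obtain \<sigma> where \<sigma>: "\<And>r u v. (u, v) \<in> parcs (network M) \<Longrightarrow> set (\<sigma> r (u, v)) \<subseteq> held M \<sigma> r u"
    and msg: "\<And>r u v w. (u, v) \<in> parcs (network M) \<Longrightarrow> w \<in> inputs M (alphabet_size P) \<Longrightarrow>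
        message M P w r (u, v) = map (\<lambda>(i, j). w ! i ! j) (\<sigma> r (u, v))"
    using P(1) unfolding routing_protocol_def by fastforce
  have cp: "coding_protocol M P" using P(1) by (simp add: routing_protocol_def)
  then have q: "alphabet_size P \<ge> 2" by (simp add: coding_protocol_def)
  have len: "length (\<sigma> r e) \<le> 1" if "e \<in> parcs (network M)" for r e
  proof -
    obtain u v where e: "e = (u, v)" by fastforce
    \<comment> \<open>Any input would do: its message lengths are those of the schedule.\<close>
    define w where "w = map (\<lambda>i. replicate (demand M i) (0::nat)) [0..<num_sessions M]"
    have w: "w \<in> inputs M (alphabet_size P)" using q by (auto simp: inputs_def w_def)
    then have "length (message M P w r (u, v)) \<le> 1"
      using cp that e cap unfolding coding_protocol_def by fastforce
    then show ?thesis using msg[OF _ w, of u v r] that e by simp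
  qed
  define S where "S = {i. i < num_sessions M \<and> T ! i < L}"
  have "\<exists>x. x \<in> {..<L} \<times> (B \<inter> parcs (network M)) \<and> (i, 0) \<in> set (\<sigma> (fst x) (snd x))" if "i \<in> S" for i
  proof -
    have i: "i < num_sessions M" "T ! i < L" "0 < demand M i"
      using that M by (auto simp: S_def multiple_unicast_def)
    have "(i, 0) \<in> held M \<sigma> (T ! i) (sink M i)"
      using routing_completion_held[OF \<sigma> msg q P(2)] i by blast
    from held_crosses[OF \<sigma> this, of B] obtain r e where "r < T ! i" "e \<in> B \<inter> parcs (network M)"
      "(i, 0) \<in> set (\<sigma> r e)" using dist i by (meson le_less_trans)
    then show ?thesis using i by (intro exI[of _ "(r, e)"]) auto
  qed
  then obtain g where g: "\<And>i. i \<in> S \<Longrightarrow> g i \<in> {..<L} \<times> (B \<inter> parcs (network M)) \<and>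
      (i, 0) \<in> set (\<sigma> (fst (g i)) (snd (g i)))" by metis
  have "inj_on g S"
  proof (rule inj_onI)
    fix i i' assume *: "i \<in> S" "i' \<in> S" "g i = g i'"
    have "length (\<sigma> (fst (g i)) (snd (g i))) \<le> 1" using g[OF *(1)] len by auto
    moreover have "(i, 0) \<in> set (\<sigma> (fst (g i)) (snd (g i)))" "(i', 0) \<in> set (\<sigma> (fst (g i)) (snd (g i)))"
      using g * by metis+
    ultimately show "i = i'" by (cases "\<sigma> (fst (g i)) (snd (g i))") auto
  qed
  moreover have "g ` S \<subseteq> {..<L} \<times> B" using g by force
  ultimately have "card S \<le> card ({..<L} \<times> B)" using B by (intro card_inj_on_le) auto
  then show ?thesis by (simp add: S_def card_cartesian_product)
qed

text \<open>Turns indistinguishability into the decoders demanded by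
  \<open>has_completion_times\<close>.\<close>

lemma factor_through:
  assumes "\<And>w w'. w \<in> I \<Longrightarrow> w' \<in> I \<Longrightarrow> K w = K w' \<Longrightarrow> g w = g w'"
  shows "\<exists>dec. \<forall>w\<in>I. dec (K w) = g w"
proof (intro exI ballI)
  fix w assume w: "w \<in> I"
  have "(SOME w'. w' \<in> I \<and> K w' = K w) \<in> I \<and> K (SOME w'. w' \<in> I \<and> K w' = K w) = K w"
    by (rule someI[of _ w]) (use w in auto)
  then show "(\<lambda>y. g (SOME w'. w' \<in> I \<and> K w' = y)) (K w) = g w" using assms w by blast
qed

lemma held_determined:
  assumes f: "\<And>r u v w. (u, v) \<in> parcs (network M) \<Longrightarrow> w \<in> inputs M q \<Longrightarrow>
        f r (u, v) w = map (\<lambda>(i, j). w ! i ! j) (\<sigma> r (u, v))"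
    and w: "w \<in> inputs M q" "w' \<in> inputs M q"
    and eq: "knowledge M w u (sent_upto M f w r) = knowledge M w' u (sent_upto M f w' r)"
    and h: "(i, j) \<in> held M \<sigma> r u"
  shows "w ! i ! j = w' ! i ! j"
proof -
  consider "i < num_sessions M" "source M i = u"
    | r' v where "r' < r" "(v, u) \<in> parcs (network M)" "(i, j) \<in> set (\<sigma> r' (v, u))"
    using h by (auto simp: held_def)
  then show ?thesis
  proof cases
    case 1
    then show ?thesis using knowledge_sent_upto_eqD(1)[OF eq] by simp
  next
    case 2
    then have "map (\<lambda>(i, j). w ! i ! j) (\<sigma> r' (v, u)) = map (\<lambda>(i, j). w' ! i ! j) (\<sigma> r' (v, u))"
      using knowledge_sent_upto_eqD(2)[OF eq 2(1,2)] f w by simp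
    then show ?thesis using 2(3) by auto
  qed
qed

section \<open>A routing protocol by flooding, and the infimum in
  \<open>best_routing\<close>\<close>

primrec flooded :: "'v unicast_instance \<Rightarrow> (nat \<times> nat) list \<Rightarrow> nat \<Rightarrow> 'v \<Rightarrow> (nat \<times> nat) set" where
  "flooded M ps 0 u = {(i, j). i < num_sessions M \<and> j < demand M i \<and> source M i = u}"
| "flooded M ps (Suc r) u = flooded M ps r u \<union>
     {p. p = ps ! (r mod length ps) \<and> (\<exists>v. (v, u) \<in> parcs (network M) \<and> p \<in> flooded M ps r v)}"

text \<open>One sub-packet per round in cyclic order, so that capacity 1 suffices.
  \<open>flooded\<close> is defined first because \<open>held\<close> depends on the schedule while
  the schedule asks what is held; \<open>held_flooding\<close> closes the circle.\<close>

definition flooding :: "'v unicast_instance \<Rightarrow> (nat \<times> nat) list \<Rightarrow> nat \<Rightarrow> 'v \<times> 'v \<Rightarrow> (nat \<times> nat) list" where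
  "flooding M ps r e =
     (if ps ! (r mod length ps) \<in> flooded M ps r (fst e) then [ps ! (r mod length ps)] else [])"

lemma held_flooding: "held M (flooding M ps) r u = flooded M ps r u"
proof (induction r arbitrary: u)
  case 0
  then show ?case by (auto simp: held_def)
next
  case (Suc r)
  have "set (flooding M ps r (v, u)) = {p. p = ps ! (r mod length ps) \<and> p \<in> flooded M ps r v}" for v
    by (auto simp: flooding_def)
  then show ?case unfolding held_Suc Suc.IH by auto
qed

text \<open>Each cycle of \<open>length ps\<close> rounds contains the turn \<open>t\<close> of the
  sub-packet and so advances it by an arc of the given walk.\<close>

lemma flooding_reaches:
  assumes "(source M i, u) \<in> parcs (network M) ^^ m" "t < length ps" "ps ! t = (i, j)"
    "i < num_sessions M" "j < demand M i"
  shows "(i, j) \<in> held M (flooding M ps) (length ps * m) u"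
  using assms(1)
proof (induction m arbitrary: u)
  case 0
  then show ?case using assms by (auto simp: held_flooding)
next
  case (Suc m)
  then obtain v where v: "(source M i, v) \<in> parcs (network M) ^^ m" "(v, u) \<in> parcs (network M)" by auto
  define r where "r = length ps * m + t"
  have r: "r mod length ps = t" using assms(2) by (simp add: r_def)
  have "(i, j) \<in> held M (flooding M ps) r v"
    using Suc.IH[OF v(1)] held_mono[of "length ps * m" r M] by (auto simp: r_def)
  then have "(i, j) \<in> held M (flooding M ps) (Suc r) u"
    using v(2) r assms(3) unfolding held_flooding by auto
  moreover have "Suc r \<le> length ps * Suc m" using assms(2) by (simp add: r_def)
  ultimately show ?case by (rule subsetD[OF held_mono, rotated])
qed

lemma connected_rtrancl:
  assumes "multiple_unicast M" "u \<in> pverts (network M)" "v \<in> pverts (network M)"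
  shows "(u, v) \<in> (parcs (network M))\<^sup>*"
proof -
  interpret pair_graph "network M" using assms(1) by (simp add: multiple_unicast_def)
  have "u \<rightarrow>\<^sup>*\<^bsub>mk_symmetric (with_proj (network M))\<^esub> v"
    using assms by (auto simp: multiple_unicast_def Digraph_Component.connected_def strongly_connected_def)
  then have "(u, v) \<in> (parcs (mk_symmetric (with_proj (network M))))\<^sup>*"
    unfolding reachable_def by (auto dest: rtrancl_on_rtranclI)
  \<comment> \<open>Connectivity is defined through the symmetric closure, which adds no arcs
    here.\<close>
  moreover have "parcs (mk_symmetric (with_proj (network M))) \<subseteq> parcs (network M)"
    using arcs_symmetric by (auto simp: parcs_mk_symmetric)
  ultimately show ?thesis using rtrancl_mono by blast
qed

text \<open>The infimum in \<open>best_routing\<close> is meaningful only over a nonempty set;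
  flooding a connected network supplies a member.\<close>

lemma routing_protocol_exists:
  assumes M: "multiple_unicast M"
  obtains P T where "routing_protocol M P" "has_completion_times M P T"
proof -
  define D where "D = (SIGMA i:{..<num_sessions M}. {..<demand M i})"
  obtain ps where ps: "set ps = D" using finite_list[of D] by (auto simp: D_def)
  define \<sigma> where "\<sigma> = flooding M ps"
  have sub: "set (\<sigma> r (u, v)) \<subseteq> held M \<sigma> r u" for r u v
    unfolding \<sigma>_def held_flooding by (auto simp: flooding_def)
  define f where "f r e w = map (\<lambda>(i, j). w ! i ! j :: nat) (\<sigma> r e)" for r e w
  have det: "f r (u, v) w = f r (u, v) w'"
    if "w \<in> inputs M 2" "w' \<in> inputs M 2"
      "knowledge M w u (sent_upto M f w r) = knowledge M w' u (sent_upto M f w' r)" for r u v w w'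
  proof -
    have "w ! i ! j = w' ! i ! j" if "(i, j) \<in> set (\<sigma> r (u, v))" for i j
      using held_determined[of M 2 f \<sigma> w w' u r i j] \<open>w \<in> inputs M 2\<close> \<open>w' \<in> inputs M 2\<close>
        \<open>knowledge M w u _ = _\<close> subsetD[OF sub that] by (simp add: f_def)
    then show ?thesis by (auto simp: f_def)
  qed
  obtain P where P: "alphabet_size P = 2"
    "\<And>w r. w \<in> inputs M 2 \<Longrightarrow> history M P w r = sent_upto M f w r"
    "\<And>w r e. w \<in> inputs M 2 \<Longrightarrow> e \<in> parcs (network M) \<Longrightarrow> message M P w r e = f r e w"
    using protocol_of_messages[of M 2 f] det by blast
  have symb: "w ! i ! j < 2" if "w \<in> inputs M 2" "(i, j) \<in> held M \<sigma> r u" for w i j r u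
  proof -
    have "i < num_sessions M" "j < demand M i" using held_valid[OF sub that(2)] by auto
    then have "length (w ! i) = demand M i" "set (w ! i) \<subseteq> {..<2}" using that(1) by (auto simp: inputs_def)
    then show ?thesis using \<open>j < demand M i\<close> nth_mem by (metis lessThan_iff subsetD)
  qed
  have "coding_protocol M P" unfolding coding_protocol_def P(1)
  proof (intro conjI allI ballI)
    fix r e assume e: "e \<in> parcs (network M)"
    obtain u v where uv: "e = (u, v)" by fastforce
    have "capacity M {u, v} \<ge> 1" using M e uv by (auto simp: multiple_unicast_def)
    then have "length (\<sigma> r (u, v)) \<le> capacity M {u, v}" by (simp add: \<sigma>_def flooding_def)
    moreover have "set (f r (u, v) w) \<subseteq> {..<2}" if "w \<in> inputs M 2" for w
      using symb[OF that] sub[of r u v] by (fastforce simp: f_def)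
    ultimately show "case e of (u, v) \<Rightarrow> \<exists>n\<le>capacity M {u, v}. \<forall>w\<in>inputs M 2.
        length (message M P w r (u, v)) = n \<and> set (message M P w r (u, v)) \<subseteq> {..<2}"
      using e uv P(3) by (auto simp: f_def intro!: exI[of _ "length (\<sigma> r (u, v))"])
  qed simp
  then have "routing_protocol M P" unfolding routing_protocol_def
    using sub P by (auto simp: f_def intro!: exI[of _ \<sigma>])
  moreover have "\<exists>m. (source M i, sink M i) \<in> parcs (network M) ^^ m" if "i < num_sessions M" for i
    using connected_rtrancl[OF M, of "source M i" "sink M i"] M that
    by (auto simp: multiple_unicast_def rtrancl_power)
  then obtain m where m: "\<And>i. i < num_sessions M \<Longrightarrow> (source M i, sink M i) \<in> parcs (network M) ^^ m i"
    by metis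
  have "has_completion_times M P (map (\<lambda>i. length ps * m i) [0..<num_sessions M])"
    unfolding has_completion_times_def P(1)
  proof (intro conjI allI impI factor_through)
    fix i w w'
    assume i: "i < num_sessions M" and w: "w \<in> inputs M 2" "w' \<in> inputs M 2"
      and eq: "knowledge M w (sink M i) (history M P w (map (\<lambda>i. length ps * m i) [0..<num_sessions M] ! i)) =
         knowledge M w' (sink M i) (history M P w' (map (\<lambda>i. length ps * m i) [0..<num_sessions M] ! i))"
    have "w ! i ! j = w' ! i ! j" if j: "j < demand M i" for j
    proof -
      have "(i, j) \<in> set ps" using i j by (simp add: ps D_def)
      then obtain t where "t < length ps" "ps ! t = (i, j)" by (auto simp: in_set_conv_nth)
      then have "(i, j) \<in> held M \<sigma> (length ps * m i) (sink M i)"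
        using flooding_reaches[OF m[OF i]] i j by (auto simp: \<sigma>_def)
      then show ?thesis using held_determined[of M 2 f \<sigma> w w' "sink M i" "length ps * m i" i j] eq i w P(2)
        by (simp add: f_def)
    qed
    moreover have "length (w ! i) = demand M i" "length (w' ! i) = demand M i"
      using w i by (auto simp: inputs_def)
    ultimately show "w ! i = w' ! i" by (auto simp: list_eq_iff_nth_eq)
  qed simp
  ultimately show ?thesis using that by blast
qed

section \<open>Norms of completion-time vectors\<close>

lemma lp_norm_ereal: "lp_norm (ereal p) T = (\<Sum>t\<leftarrow>T. real t powr p) powr (1 / p)"
  by (simp add: lp_norm_def)

lemma lp_norm_replicate:
  assumes "p \<ge> 1" "k \<ge> 1"
  shows "lp_norm p (replicate k a) = (if p = \<infinity> then 1 else real k powr (1 / real_of_ereal p)) * real a"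
proof (cases p)
  case (real r)
  then have "r \<ge> 1" using assms by simp
  then show ?thesis using real by (simp add: lp_norm_ereal sum_list_replicate powr_mult powr_powr)
qed (use assms in \<open>auto simp: lp_norm_def\<close>)

lemma sum_list_powr_ge:
  "real (card {i. i < length T \<and> T ! i \<ge> L}) * real L powr r \<le> (\<Sum>t\<leftarrow>T. real t powr r)" if "r \<ge> 0"
proof -
  have "(\<Sum>t\<leftarrow>T. real t powr r) = (\<Sum>i<length T. real (T ! i) powr r)"
    by (simp add: sum_list_sum_nth atLeast0LessThan)
  also have "\<dots> \<ge> (\<Sum>i\<in>{i. i < length T \<and> T ! i \<ge> L}. real (T ! i) powr r)"
    by (intro sum_mono2) auto
  moreover have "(\<Sum>i\<in>{i. i < length T \<and> T ! i \<ge> L}. real (T ! i) powr r) \<ge>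
      (\<Sum>i\<in>{i. i < length T \<and> T ! i \<ge> L}. real L powr r)"
    using that by (intro sum_mono powr_mono2) auto
  ultimately show ?thesis by simp
qed

text \<open>With at least half of the entries at \<open>L\<close> or more, the norm loses at most
  the factor \<open>(1 / 2) powr (1 / r)\<close> against the constant vector \<open>L\<close>, and
  this is at least 1/2 as \<open>r \<ge> 1\<close>. For the maximum norm one such entry
  suffices.\<close>

lemma lp_norm_ge:
  assumes "p \<ge> 1" "T \<noteq> []" "2 * card {i. i < length T \<and> T ! i < L} \<le> length T"
  shows "lp_norm p T \<ge> (if p = \<infinity> then 1 else real (length T) powr (1 / real_of_ereal p)) * real L / 2"
proof -
  define S where "S = {i. i < length T \<and> T ! i \<ge> L}"
  have "{..<length T} = {i. i < length T \<and> T ! i < L} \<union> S" by (auto simp: S_def)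
  then have "length T = card ({i. i < length T \<and> T ! i < L} \<union> S)" by (metis card_lessThan)
  also have "\<dots> \<le> card {i. i < length T \<and> T ! i < L} + card S" by (rule card_Un_le)
  finally have S: "real (length T) / 2 \<le> real (card S)" using assms(3) by linarith
  show ?thesis
  proof (cases p)
    case (real r)
    then have r: "r \<ge> 1" using assms by simp
    have "real (length T) / 2 * real L powr r \<le> (\<Sum>t\<leftarrow>T. real t powr r)"
      using order_trans[OF mult_right_mono[OF S] sum_list_powr_ge[of r T L, folded S_def]] r by simp
    then have "(real (length T) / 2 * real L powr r) powr (1 / r) \<le> lp_norm p T"
      unfolding real lp_norm_ereal using r by (intro powr_mono2) auto
    moreover have "(real (length T) / 2 * real L powr r) powr (1 / r)
        = real (length T) powr (1 / r) * real L * (1 / 2) powr (1 / r)"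
      using r by (simp add: powr_mult powr_powr powr_divide)
    moreover have "(1 / 2) powr (1 / r) \<ge> (1 / 2 :: real)"
      using powr_mono'[of "1 / r" 1 "1 / 2"] r by simp
    then have "real (length T) powr (1 / r) * real L * (1 / 2) powr (1 / r) \<ge>
        real (length T) powr (1 / r) * real L * (1 / 2)" by (intro mult_left_mono) auto
    ultimately show ?thesis using real by simp
  next
    case PInf
    have "S \<noteq> {}" using S assms(2) by (metis card.empty half_gt_zero_iff length_greater_0_conv not_less of_nat_0 of_nat_0_less_iff)
    then obtain i where "i < length T" "T ! i \<ge> L" by (auto simp: S_def)
    then have "real L \<le> Max (real ` set T)" by (intro order_trans[OF _ Max.coboundedI, of _ "real (T ! i)"]) auto
    then show ?thesis using PInf by (simp add: lp_norm_def)
  qed (use assms in auto)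
qed

lemma lp_norm_ge_1:
  assumes "p \<ge> 1" "T \<noteq> []" "\<And>i. i < length T \<Longrightarrow> T ! i \<ge> 1"
  shows "lp_norm p T \<ge> 1"
proof (cases p)
  case (real r)
  then have r: "r \<ge> 1" using assms by simp
  have "{i. i < length T \<and> T ! i \<ge> 1} = {..<length T}" using assms(3) by auto
  then have "(\<Sum>t\<leftarrow>T. real t powr r) \<ge> 1"
    using sum_list_powr_ge[of r T 1] r order_trans[of 1 "real (length T)"] assms(2)
    by (simp add: Suc_le_eq)
  then show ?thesis unfolding real lp_norm_ereal using r by (intro ge_one_powr_ge_zero) auto
next
  case PInf
  have "T ! 0 \<ge> 1" "T ! 0 \<in> set T" using assms by auto
  then have "1 \<le> Max (real ` set T)" by (intro order_trans[OF _ Max.coboundedI, of _ "real (T ! 0)"]) auto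
  then show ?thesis using PInf by (simp add: lp_norm_def)
qed (use assms in auto)

text \<open>Both bounds carry the factor \<open>c\<close>, the norm of the all-ones vector of length
  \<open>k\<close>; it cancels, and the result does not depend on \<open>p\<close>.\<close>

lemma coding_gap_ge:
  assumes M: "multiple_unicast M" and p: "p \<ge> 1" and a: "a \<ge> 1"
    and ne: "\<And>i. i < num_sessions M \<Longrightarrow> source M i \<noteq> sink M i"
    and coding: "coding_protocol M P" "has_completion_times M P (replicate (num_sessions M) a)"
    and routing: "\<And>P T. routing_protocol M P \<Longrightarrow> has_completion_times M P T \<Longrightarrow>
        2 * card {i. i < num_sessions M \<and> T ! i < L} \<le> num_sessions M"
  shows "coding_gap p M \<ge> real L / (2 * real a)"
proof -
  define k where "k = num_sessions M"
  have k: "k \<ge> 1" using M by (auto simp: k_def multiple_unicast_def)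
  define c where "c = (if p = \<infinity> then 1 else real k powr (1 / real_of_ereal p))"
  have c: "c > 0" using k by (auto simp: c_def)
  let ?C = "{lp_norm p T | T P. coding_protocol M P \<and> has_completion_times M P T}"
  let ?R = "{lp_norm p T | T P. routing_protocol M P \<and> has_completion_times M P T}"
  have ge1: "x \<ge> 1" if x: "x \<in> ?C" for x
  proof -
    obtain T P where T: "x = lp_norm p T" "coding_protocol M P" "has_completion_times M P T" using x by auto
    then have len: "length T = k" by (simp add: has_completion_times_def k_def)
    show ?thesis unfolding T(1)
    proof (rule lp_norm_ge_1[OF p])
      show "T \<noteq> []" using len k by auto
      fix i assume "i < length T"
      then show "T ! i \<ge> 1" using len M coding_completion_pos[OF T(2,3), of i] ne
        by (auto simp: k_def multiple_unicast_def)
    qed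
  qed
  have "lp_norm p (replicate k a) \<in> ?C" using coding by (auto simp: k_def)
  then have le: "best_coding p M \<le> c * real a" and "best_coding p M \<ge> 1"
    unfolding best_coding_def using ge1
    by (auto simp: lp_norm_replicate[OF p k] c_def intro!: cInf_lower2 bdd_belowI[of _ 1] cInf_greatest)
  then have pos: "best_coding p M > 0" by linarith
  have "best_routing p M \<ge> c * real L / 2"
    unfolding best_routing_def
  proof (rule cInf_greatest)
    show "?R \<noteq> {}" by (rule routing_protocol_exists[OF M]) auto
    fix x assume "x \<in> ?R"
    then obtain T P where T: "x = lp_norm p T" "routing_protocol M P" "has_completion_times M P T" by auto
    then have len: "length T = k" by (simp add: has_completion_times_def k_def)
    have "T \<noteq> []" using len k by auto
    moreover have "2 * card {i. i < length T \<and> T ! i < L} \<le> length T"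
      using routing[OF T(2,3)] len by (simp add: k_def)
    ultimately show "c * real L / 2 \<le> x" using lp_norm_ge[OF p, of T L, unfolded len, folded c_def] len by (simp add: T(1))
  qed
  then have "coding_gap p M \<ge> (c * real L / 2) / best_coding p M"
    unfolding coding_gap_def using pos by (intro divide_right_mono) auto
  moreover have "(c * real L / 2) / best_coding p M \<ge> (c * real L / 2) / (c * real a)"
    using le pos c by (intro divide_left_mono) auto
  moreover have "(c * real L / 2) / (c * real a) = real L / (2 * real a)" using c by simp
  ultimately show ?thesis by linarith
qed

section \<open>From core graphs to instances\<close>

text \<open>
  A transcript is a coding scheme seen from outside: it gives the bit sent over every arc in every
  round as a function of the source bits, and each bit is determined by what its sender knows.
\<close>

type_synonym 'a rounds = "('a \<times> 'a \<Rightarrow> (nat \<Rightarrow> bool) \<Rightarrow> bool) list"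

text \<open>Knowledge is semantic, a matter of inputs that \<open>u\<close> cannot tell apart, so
  that coding arguments need not exhibit decoding functions.\<close>

definition knows :: "('a \<times> 'a) set \<Rightarrow> 'a list \<Rightarrow> 'a rounds \<Rightarrow> 'a \<Rightarrow> ((nat \<Rightarrow> bool) \<Rightarrow> bool) \<Rightarrow> bool" where
  "knows A S F u \<phi> \<longleftrightarrow> (\<forall>x y.
     (\<forall>i<length S. S ! i = u \<longrightarrow> x i = y i) \<longrightarrow>
     (\<forall>r<length F. \<forall>v. (v, u) \<in> A \<longrightarrow> (F ! r) (v, u) x = (F ! r) (v, u) y) \<longrightarrow> \<phi> x = \<phi> y)"

inductive transcript :: "('a \<times> 'a) set \<Rightarrow> 'a list \<Rightarrow> 'a rounds \<Rightarrow> bool" for A S where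
  Nil: "transcript A S []"
| snoc: "transcript A S F \<Longrightarrow> (\<And>u v. (u, v) \<in> A \<Longrightarrow> knows A S F u (m (u, v))) \<Longrightarrow> transcript A S (F @ [m])"

lemma transcript_knows:
  assumes "transcript A S F" "r < length F" "(u, v) \<in> A"
  shows "knows A S (take r F) u ((F ! r) (u, v))"
  using assms
proof (induction rule: transcript.induct)
  case (snoc F m)
  then show ?case by (cases "r = length F") (auto simp: nth_append)
qed simp

lemma relpow_inj_image:
  assumes "inj f" "(f x, y) \<in> (map_prod f f ` R) ^^ n"
  shows "\<exists>z. y = f z \<and> (x, z) \<in> R ^^ n"
  using assms(2)
proof (induction n arbitrary: y)
  case (Suc n)
  then obtain y' where "(f x, y') \<in> (map_prod f f ` R) ^^ n" "(y', y) \<in> map_prod f f ` R" by auto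
  with Suc.IH obtain z where z: "y' = f z" "(x, z) \<in> R ^^ n" by blast
  then obtain z' where "y = f z'" "(z, z') \<in> R"
    using \<open>(y', y) \<in> _\<close> injD[OF assms(1)] by auto
  with z show ?case by auto
qed auto

lemma rtrancl_image:
  assumes "(x, y) \<in> R\<^sup>*"
  shows "(f x, f y) \<in> (map_prod f f ` R)\<^sup>*"
  using assms by (induction rule: rtrancl_induct) (auto intro: rtrancl_into_rtrancl)

text \<open>
  Any core graph becomes connected, without creating new walks of length less than L between core
  vertices, once a path of length L is attached to every vertex and the far ends are joined.
\<close>

definition tailed :: "'a set \<Rightarrow> ('a \<times> 'a) set \<Rightarrow> nat \<Rightarrow> (('a \<times> nat) \<times> ('a \<times> nat)) set" where
  "tailed V A L = {((u, 0), (v, 0)) | u v. (u, v) \<in> A} \<union>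
     {((u, j), (u, Suc j)) | u j. u \<in> V \<and> j < L} \<union> {((u, Suc j), (u, j)) | u j. u \<in> V \<and> j < L} \<union>
     {((u, L), (v, L)) | u v. u \<in> V \<and> v \<in> V \<and> u \<noteq> v}"

text \<open>The height on a tail grows by at most one per step, so fewer than \<open>L\<close> steps
  from a core vertex never reach the joined far ends. Steps on a tail keep the first coordinate;
  dropping them leaves a core walk.\<close>

lemma tailed_walk:
  assumes "((u, 0), (v, j)) \<in> (tailed V A L - {((u, 0), (v, 0)) | u v. (u, v) \<in> B}) ^^ n" "n < L"
  shows "j \<le> n \<and> (\<exists>m\<le>n. (u, v) \<in> (A - B) ^^ m)"
  using assms
proof (induction n arbitrary: v j)
  case 0
  then show ?case by auto
next
  case (Suc n)
  obtain p where p: "((u, 0), p) \<in> (tailed V A L - {((u, 0), (v, 0)) | u v. (u, v) \<in> B}) ^^ n"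
    "(p, (v, j)) \<in> tailed V A L - {((u, 0), (v, 0)) | u v. (u, v) \<in> B}"
    using Suc.prems(1) by (rule relpow_Suc_E)
  obtain v' j' where "p = (v', j')" by fastforce
  with p have w: "((u, 0), (v', j')) \<in> (tailed V A L - {((u, 0), (v, 0)) | u v. (u, v) \<in> B}) ^^ n"
    and s: "((v', j'), (v, j)) \<in> tailed V A L - {((u, 0), (v, 0)) | u v. (u, v) \<in> B}"
    by simp_all
  obtain m where m: "j' \<le> n" "m \<le> n" "(u, v') \<in> (A - B) ^^ m" using Suc.IH[OF w] Suc.prems(2) by auto
  have "j' \<noteq> L" using m Suc.prems(2) by auto
  then consider "j' = 0" "j = 0" "(v', v) \<in> A - B" | "v = v'" "j \<le> Suc j'"
    using s by (auto simp: tailed_def)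
  then show ?case
  proof cases
    case 1
    then have "(u, v) \<in> (A - B) ^^ Suc m" using m by auto
    then show ?thesis using 1 m by (intro conjI exI[of _ "Suc m"]) auto
  next
    case 2
    then show ?thesis using m by (intro conjI exI[of _ m]) auto
  qed
qed

text \<open>Any two tails are linked through their far ends, and symmetry lets every tail be walked
  both ways.\<close>

lemma tailed_connected:
  assumes "sym A" "L \<ge> 1" "u \<in> V" "v \<in> V" "j \<le> L" "j' \<le> L"
  shows "((u, j), (v, j')) \<in> (tailed V A L)\<^sup>*"
proof -
  have sy: "sym ((tailed V A L)\<^sup>*)"
    using assms(1) by (intro sym_rtrancl) (auto simp: tailed_def sym_def)
  have up: "((u, 0), (u, j)) \<in> (tailed V A L)\<^sup>*" if "u \<in> V" "j \<le> L" for u j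
    using that(2)
  proof (induction j)
    case (Suc j)
    then have "((u, j), (u, Suc j)) \<in> tailed V A L" using that by (auto simp: tailed_def)
    with Suc show ?case by (auto intro: rtrancl_into_rtrancl)
  qed simp
  have "((u, L), (v, L)) \<in> (tailed V A L)\<^sup>*"
    using assms(3,4) by (cases "u = v") (auto simp: tailed_def)
  then have "((u, 0), (v, 0)) \<in> (tailed V A L)\<^sup>*"
    using up[OF assms(3), of L] up[OF assms(4), of L] sy by (meson order_refl rtrancl_trans symD)
  then show ?thesis using up[OF assms(3,5)] up[OF assms(4,6)] sy by (meson rtrancl_trans symD)
qed

text \<open>Reduces the gap to graph data: the transcript bounds the coding time by
  \<open>a\<close>, while \<open>far\<close> and the size of \<open>B\<close> force at least half of
  the sessions to take \<open>L\<close> rounds when routed.\<close>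

theorem core_instance:
  fixes V :: "'a :: countable set" and A B :: "('a \<times> 'a) set" and S T :: "'a list" and F :: "'a rounds"
  assumes V: "finite V" "A \<subseteq> V \<times> V" "sym A" "irrefl A" "set S \<subseteq> V" "set T \<subseteq> V"
    and k: "length S = k" "length T = k" "k \<ge> 1" and ne: "\<And>i. i < k \<Longrightarrow> S ! i \<noteq> T ! i"
    and F: "transcript A S F" "length F = a" "a \<ge> 1" "\<And>i. i < k \<Longrightarrow> knows A S F (T ! i) (\<lambda>x. x i)"
    and L: "L \<ge> 1" and B: "B \<subseteq> A" "2 * L * card B \<le> k"
    and far: "\<And>i n. i < k \<Longrightarrow> n < L \<Longrightarrow> (S ! i, T ! i) \<notin> (A - B) ^^ n"
  obtains M :: "nat unicast_instance" where "multiple_unicast M" "num_sessions M = k"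
    "\<And>p. p \<ge> 1 \<Longrightarrow> coding_gap p M \<ge> real L / (2 * real a)"
proof -
  define enc :: "'a \<times> nat \<Rightarrow> nat" where "enc = to_nat"
  have inj: "inj enc" by (simp add: enc_def)
  define R where "R = tailed V A L"
  define es where "es = map_prod enc enc ` R"
  define vs where "vs = enc ` (V \<times> {..L})"
  \<comment> \<open>With unit capacities and demands and the alphabet of size 2, a packet is one bit
    and so is every nonempty message.\<close>
  define M where "M = \<lparr>network = \<lparr>pverts = vs, parcs = es\<rparr>, capacity = (\<lambda>_. 1::nat),
     sessions = map (\<lambda>(u, v). (enc (u, 0), enc (v, 0), 1::nat)) (zip S T)\<rparr>"
  have ns: "num_sessions M = k" using k by (simp add: M_def num_sessions_def)
  have src: "source M i = enc (S ! i, 0)" "sink M i = enc (T ! i, 0)" "demand M i = 1" if "i < k" for i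
    using that k by (auto simp: M_def source_def sink_def demand_def)
  have Mp [simp]: "parcs (network M) = es" "pverts (network M) = vs" "capacity M e = 1" for e
    by (auto simp: M_def)
  have R_sub: "R \<subseteq> (V \<times> {..L}) \<times> (V \<times> {..L})" using V(2) by (auto simp: R_def tailed_def)
  have arcs_sub: "es \<subseteq> vs \<times> vs" using R_sub by (force simp: es_def vs_def)
  have finv: "finite vs" using V by (simp add: vs_def)
  have fina: "finite es" using finite_subset[OF arcs_sub] finv by simp
  have sym_R: "sym R" using V(3) by (auto simp: R_def tailed_def sym_def)
  have sym_arcs: "sym es" using sym_R by (force simp: es_def sym_def)
  have irr: "(p, p) \<notin> R" for p using V(4) by (auto simp: R_def tailed_def irrefl_def)
  have pg: "pair_graph (network M)"
  proof
    show "fst e \<in> pverts (network M)" "snd e \<in> pverts (network M)" if "e \<in> parcs (network M)" for e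
      using that arcs_sub by auto
    show "fst e \<noteq> snd e" if "e \<in> parcs (network M)" for e
      using that irr by (auto simp: es_def inj_eq[OF inj])
    show "symmetric (with_proj (network M))" using sym_arcs by (simp add: symmetric_def)
  qed (use finv fina in auto)
  have "Digraph_Component.connected (with_proj (network M))"
    unfolding connected_conv with_proj_simps Mp
  proof (intro conjI ballI)
    show "vs \<noteq> {}" using k V by (cases S) (auto simp: vs_def)
    fix a b assume ab: "a \<in> vs" "b \<in> vs"
    then have "(a, b) \<in> es\<^sup>*"
      using tailed_connected[OF V(3) L] by (auto simp: vs_def es_def R_def intro!: rtrancl_image)
    then have "(a, b) \<in> rtrancl_on vs es"
      using ab arcs_sub by (intro rtrancl_consistent_rtrancl_on) auto
    then show "(a, b) \<in> rtrancl_on vs (es\<^sup>s)"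
      by (rule rtrancl_on_mono[rotated 2]) (auto simp: symcl_def)
  qed
  moreover have "enc (S ! i, 0) \<in> vs" "enc (T ! i, 0) \<in> vs" if "i < k" for i
    using subsetD[OF V(5), of "S ! i"] subsetD[OF V(6), of "T ! i"] k that by (auto simp: vs_def intro!: imageI)
  ultimately have mu: "multiple_unicast M" unfolding multiple_unicast_def
    using pg k ns src by auto

  define dec where "dec = (\<lambda>(a, b). (fst (from_nat a :: 'a \<times> nat), fst (from_nat b :: 'a \<times> nat)))"
  have dec: "dec (enc (u, 0), enc (v, 0)) = (u, v)" for u v by (simp add: dec_def enc_def)
  define bits where "bits w = (\<lambda>i. w ! i ! 0 = (1::nat))" for w
  define core where "core = {(enc (u, 0), enc (v, 0)) | u v. (u, v) \<in> A}"
  have core: "(enc (u, 0), enc (v, 0)) \<in> es" if "(u, v) \<in> A" for u v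
  proof -
    have "((u, 0), (v, 0)) \<in> R" using that by (auto simp: R_def tailed_def)
    then show ?thesis by (force simp: es_def)
  qed
  \<comment> \<open>Tail arcs stay silent, and so does everything after the last round of
    \<open>F\<close>; message lengths thus depend only on round and arc.\<close>
  define f :: "nat \<Rightarrow> nat \<times> nat \<Rightarrow> nat list list \<Rightarrow> nat list" where
    "f r e w = (if r < length F \<and> e \<in> core then [of_bool ((F ! r) (dec e) (bits w))] else [])" for r e w
  have f_core: "f r (enc (u, 0), enc (v, 0)) w = [of_bool ((F ! r) (u, v) (bits w))]"
    if "r < length F" "(u, v) \<in> A" for r u v w
    using that by (auto simp: f_def dec core_def)
  \<comment> \<open>Carries \<open>knows\<close> over to \<open>knowledge\<close>; used both for the
    locality of the messages and for decoding at the sinks.\<close>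
  have learn: "\<phi> (bits w) = \<phi> (bits w')"
    if kn: "knows A S (take r F) u \<phi>" and r: "r \<le> length F"
      and eq: "knowledge M w (enc (u, 0)) (sent_upto M f w r) = knowledge M w' (enc (u, 0)) (sent_upto M f w' r)"
    for w w' u \<phi> r
  proof -
    have 1: "bits w i = bits w' i" if "i < length S" "S ! i = u" for i
      using knowledge_sent_upto_eqD(1)[OF eq, of i] src that ns k by (simp add: bits_def)
    have 2: "(F ! r') (v, u) (bits w) = (F ! r') (v, u) (bits w')" if "r' < r" "(v, u) \<in> A" for r' v
      using knowledge_sent_upto_eqD(2)[OF eq that(1), of "enc (v, 0)"] core[OF that(2)] f_core[of r' v u] that r
      by (simp add: of_bool_eq_iff)
    show ?thesis using kn 1 2 unfolding knows_def by simp
  qed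
  obtain P where P: "alphabet_size P = 2"
    "\<And>w r. w \<in> inputs M 2 \<Longrightarrow> history M P w r = sent_upto M f w r"
    "\<And>w r e. w \<in> inputs M 2 \<Longrightarrow> e \<in> parcs (network M) \<Longrightarrow> message M P w r e = f r e w"
  proof (rule protocol_of_messages[of M 2 f])
    fix r u v w w'
    assume eq: "knowledge M w u (sent_upto M f w r) = knowledge M w' u (sent_upto M f w' r)"
    show "f r (u, v) w = f r (u, v) w'"
    proof (cases "r < length F \<and> (u, v) \<in> core")
      case True
      then obtain u' v' where uv: "u = enc (u', 0)" "v = enc (v', 0)" "(u', v') \<in> A" by (auto simp: core_def)
      have "(F ! r) (u', v') (bits w) = (F ! r) (u', v') (bits w')"
        using True eq unfolding uv(1) by (intro learn[OF transcript_knows[OF F(1) _ uv(3)]]) simp_all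
      then show ?thesis using f_core[OF _ uv(3)] uv True by simp
    qed (simp add: f_def)
  qed blast
  have cod: "coding_protocol M P" unfolding coding_protocol_def P(1)
  proof (intro conjI allI ballI)
    fix r e assume e: "e \<in> parcs (network M)"
    show "case e of (u, v) \<Rightarrow> \<exists>n\<le>capacity M {u, v}. \<forall>w\<in>inputs M 2.
        length (message M P w r (u, v)) = n \<and> set (message M P w r (u, v)) \<subseteq> {..<2}"
      using e P(3) by (auto simp: f_def intro!: exI[of _ "if r < length F \<and> e \<in> core then 1 else 0"])
  qed simp
  have times: "has_completion_times M P (replicate (num_sessions M) a)"
    unfolding has_completion_times_def P(1)
  proof (intro conjI allI impI factor_through)
    fix i w w'
    assume i: "i < num_sessions M" and w: "w \<in> inputs M 2" "w' \<in> inputs M 2"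
      and eq: "knowledge M w (sink M i) (history M P w (replicate (num_sessions M) a ! i)) =
         knowledge M w' (sink M i) (history M P w' (replicate (num_sessions M) a ! i))"
    have "bits w i = bits w' i"
      using learn[of "length F" "T ! i" "\<lambda>x. x i" w w'] F i ns eq src P(2) w by simp
    moreover have "length (w ! i) = 1" "length (w' ! i) = 1" "set (w ! i) \<subseteq> {..<2}" "set (w' ! i) \<subseteq> {..<2}"
      using w i ns src by (auto simp: inputs_def)
    then obtain b b' where "w ! i = [b]" "w' ! i = [b']" "b < 2" "b' < 2"
      by (auto simp: length_Suc_conv)
    ultimately show "w ! i = w' ! i" by (auto simp: bits_def less_2_cases_iff)
  qed simp

  define B' where "B' = {((u, 0::nat), (v, 0::nat)) | u v. (u, v) \<in> B}"
  define N where "N = map_prod enc enc ` B'"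
  have finB: "finite B" using B(1) V by (meson finite_SigmaI finite_subset)
  have B'_eq: "B' = (\<lambda>(u, v). ((u, 0), (v, 0))) ` B" by (auto simp: B'_def)
  then have cardN: "finite N" "card N \<le> card B"
    using finB card_image_le[OF finB] card_image_le[of B' "map_prod enc enc"] by (auto simp: N_def intro: order_trans)
  have arcs_N: "es - N = map_prod enc enc ` (R - B')"
    unfolding es_def N_def using inj by (intro image_set_diff[symmetric] prod.inj_map)
  have routing: "2 * card {i. i < num_sessions M \<and> T' ! i < L} \<le> num_sessions M"
    if "routing_protocol M Q" "has_completion_times M Q T'" for Q T'
  proof -
    have "(source M i, sink M i) \<notin> (parcs (network M) - N) ^^ n" if "i < num_sessions M" "n < L" for i n
    proof
      assume "(source M i, sink M i) \<in> (parcs (network M) - N) ^^ n"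
      then have "(enc (S ! i, 0), enc (T ! i, 0)) \<in> (map_prod enc enc ` (R - B')) ^^ n"
        using that ns src arcs_N by simp
      from relpow_inj_image[OF inj this] have "((S ! i, 0), (T ! i, 0)) \<in> (R - B') ^^ n"
        using injD[OF inj] by blast
      from tailed_walk[OF this[unfolded R_def B'_def] that(2)] show False
        using far[of i] that ns by (meson le_less_trans)
    qed
    from routing_slow_sessions[OF mu Mp(3) that this cardN(1)]
    have "card {i. i < num_sessions M \<and> T' ! i < L} \<le> L * card N" .
    also have "\<dots> \<le> L * card B" using cardN by simp
    finally show ?thesis using B(2) ns by simp
  qed
  have "coding_gap p M \<ge> real L / (2 * real a)" if "p \<ge> 1" for p
  proof (rule coding_gap_ge[OF mu that F(3) _ cod times routing])
    show "source M i \<noteq> sink M i" if "i < num_sessions M" for i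
      using that ne ns src by (simp add: inj_eq[OF inj])
  qed
  then show ?thesis using that mu ns by blast
qed

section \<open>Edge-coloured graphs of high girth\<close>

text \<open>The involutions z -> a + 1/(z - a), a = 2l, play ping-pong on the discs of radius 1 about a.\<close>

definition refl_vec :: "nat \<Rightarrow> int \<times> int \<Rightarrow> int \<times> int" where
  "refl_vec l v = (let a = 2 * int l in (a * fst v + (1 - a\<^sup>2) * snd v, fst v - a * snd v))"

text \<open>Projectively \<open>(1, 0)\<close> is the point at infinity, and this is its image under
  the composed involutions. Equally it is the first column of the product of their matrices.\<close>

definition word_vec :: "nat list \<Rightarrow> int \<times> int" where
  "word_vec ls = foldr refl_vec ls (1, 0)"

lemma word_vec_simps [simp]:
  "word_vec [] = (1, 0)" "word_vec (l # ls) = refl_vec l (word_vec ls)"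
  by (simp_all add: word_vec_def)

text \<open>The image of the shorter word lies in the open unit disc about \<open>2 * k\<close>,
  hence at distance more than 1 from \<open>2 * l\<close>, and the involution of \<open>l\<close>
  moves it into the disc about \<open>2 * l\<close>. The inequality expresses this with denominators
  cleared; in particular the second entry is nonzero.\<close>

lemma word_vec_ping_pong:
  assumes "distinct_adj (l # ls)"
  shows "\<bar>fst (word_vec (l # ls)) - 2 * int l * snd (word_vec (l # ls))\<bar> < \<bar>snd (word_vec (l # ls))\<bar>"
  using assms
proof (induction ls arbitrary: l)
  case Nil
  then show ?case by (simp add: refl_vec_def)
next
  case (Cons k ks)
  obtain p q where pq: "word_vec (k # ks) = (p, q)" by fastforce
  have lk: "l \<noteq> k" "distinct_adj (k # ks)" using Cons.prems by (auto simp: distinct_adj_Cons)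
  have ih: "\<bar>p - 2 * int k * q\<bar> < \<bar>q\<bar>" using Cons.IH[OF lk(2)] pq by simp
  have "\<bar>q\<bar> < \<bar>p - 2 * int l * q\<bar>"
  proof -
    \<comment> \<open>The two centres are at least 2 apart.\<close>
    have "2 * \<bar>q\<bar> \<le> \<bar>2 * (int k - int l) * q\<bar>"
    proof -
      have "1 \<le> \<bar>int k - int l\<bar>" using lk(1) by linarith
      then have "1 * \<bar>q\<bar> \<le> \<bar>int k - int l\<bar> * \<bar>q\<bar>" by (rule mult_right_mono) simp
      moreover have "\<bar>2 * (int k - int l) * q\<bar> = 2 * (\<bar>int k - int l\<bar> * \<bar>q\<bar>)"
        by (simp only: abs_mult abs_numeral mult.assoc)
      ultimately show ?thesis by linarith
    qed
    also have "2 * (int k - int l) * q = (p - 2 * int l * q) - (p - 2 * int k * q)"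
      by (simp add: algebra_simps)
    finally show ?thesis using ih by linarith
  qed
  moreover have "word_vec (l # k # ks) = (2 * int l * p + (1 - (2 * int l)\<^sup>2) * q, p - 2 * int l * q)"
    using pq by (simp add: refl_vec_def Let_def)
  moreover have "2 * int l * p + (1 - (2 * int l)\<^sup>2) * q - 2 * int l * (p - 2 * int l * q) = q"
    by (simp add: algebra_simps power2_eq_square)
  ultimately show ?case by simp
qed

text \<open>One letter enlarges the entries by a factor of at most \<open>1 + a + a\<^sup>2\<close>,
  hence of at most \<open>(2 * int m + 1)\<^sup>2\<close>.\<close>

lemma word_vec_bound:
  assumes "\<forall>l\<in>set ls. l \<le> m"
  shows "\<bar>fst (word_vec ls)\<bar> \<le> (2 * int m + 1) ^ (2 * length ls) \<and>
         \<bar>snd (word_vec ls)\<bar> \<le> (2 * int m + 1) ^ (2 * length ls)"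
  using assms
proof (induction ls)
  case Nil
  then show ?case by simp
next
  case (Cons l ls)
  obtain p q where pq: "word_vec ls = (p, q)" by fastforce
  define a where "a = 2 * int l"
  define X where "X = (2 * int m + 1) ^ (2 * length ls)"
  have X: "\<bar>p\<bar> \<le> X" "\<bar>q\<bar> \<le> X" "X \<ge> 0" using Cons pq by (auto simp: X_def)
  have a: "0 \<le> a" "a \<le> 2 * int m" using Cons.prems by (auto simp: a_def)
  have "\<bar>(1 - a\<^sup>2) * q\<bar> \<le> (1 + a\<^sup>2) * X"
    unfolding abs_mult using X zero_le_power2[of a] by (intro mult_mono) (auto simp: abs_le_iff)
  moreover have "\<bar>a * p\<bar> \<le> a * X" "\<bar>a * q\<bar> \<le> a * X"
    unfolding abs_mult using a X by (auto intro: mult_mono)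
  ultimately have "\<bar>a * p + (1 - a\<^sup>2) * q\<bar> \<le> (1 + a + a\<^sup>2) * X" "\<bar>p - a * q\<bar> \<le> (1 + a) * X"
    using X by (auto simp: algebra_simps)
  moreover have "(1 + a + a\<^sup>2) * X \<le> (2 * int m + 1)\<^sup>2 * X"
  proof (rule mult_right_mono)
    have "1 + a + a\<^sup>2 \<le> (a + 1)\<^sup>2" using a by (simp add: power2_eq_square algebra_simps)
    also have "\<dots> \<le> (2 * int m + 1)\<^sup>2" using a by (intro power_mono) auto
    finally show "1 + a + a\<^sup>2 \<le> (2 * int m + 1)\<^sup>2" .
  qed (use X in auto)
  moreover have "(1 + a) * X \<le> (1 + a + a\<^sup>2) * X" using X by (intro mult_right_mono) auto
  moreover have "(2 * int m + 1) ^ (2 * length (l # ls)) = (2 * int m + 1)\<^sup>2 * X"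
    by (simp add: X_def power_add power2_eq_square)
  ultimately show ?case using pq by (simp add: refl_vec_def Let_def a_def)
qed

section \<open>Involutory matrices modulo n\<close>

type_synonym matrix2 = "(int \<times> int) \<times> (int \<times> int)"

text \<open>Right multiplication, modulo n, by the matrix of the linear map refl_vec l.\<close>

definition refl_act :: "int \<Rightarrow> matrix2 \<Rightarrow> nat \<Rightarrow> matrix2" where
  "refl_act n x l = (let a = 2 * int l in
     case x of ((x1, x2), (x3, x4)) \<Rightarrow>
       (((a * x1 + x2) mod n, ((1 - a\<^sup>2) * x1 - a * x2) mod n),
        ((a * x3 + x4) mod n, ((1 - a\<^sup>2) * x3 - a * x4) mod n)))"

text \<open>Both signs of the determinant occur because each involution has determinant -1. Entries
  are canonical residues, so that congruent matrices are equal.\<close>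

definition unimodular :: "int \<Rightarrow> matrix2 set" where
  "unimodular n = {((x1, x2), (x3, x4)). {x1, x2, x3, x4} \<subseteq> {0..<n} \<and>
     ((x1 * x4 - x2 * x3) mod n = 1 mod n \<or> (x1 * x4 - x2 * x3) mod n = (-1) mod n)}"

lemma refl_act_unimodular:
  assumes "n > 0" "x \<in> unimodular n"
  shows "refl_act n x l \<in> unimodular n"
proof -
  obtain x1 x2 x3 x4 where x: "x = ((x1, x2), (x3, x4))" by (metis surj_pair)
  define a where "a = 2 * int l"
  have eq: "(a * x1 + x2) * ((1 - a\<^sup>2) * x3 - a * x4) - ((1 - a\<^sup>2) * x1 - a * x2) * (a * x3 + x4)
     = - (x1 * x4 - x2 * x3)" by (simp add: algebra_simps power2_eq_square)
  have "(((a * x1 + x2) mod n) * (((1 - a\<^sup>2) * x3 - a * x4) mod n)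
       - (((1 - a\<^sup>2) * x1 - a * x2) mod n) * ((a * x3 + x4) mod n)) mod n
     = (- (x1 * x4 - x2 * x3)) mod n"
    unfolding eq[symmetric] cong_def[symmetric] by (intro cong_refl cong_add cong_diff cong_mult) simp_all
  moreover have "(- (x1 * x4 - x2 * x3)) mod n = 1 mod n \<or> (- (x1 * x4 - x2 * x3)) mod n = (-1) mod n"
    using assms(2) unfolding x unimodular_def
    by (auto simp del: minus_diff_eq) (metis mod_minus_cong minus_minus)+
  ultimately show ?thesis using assms(1)
    by (simp add: x refl_act_def unimodular_def Let_def a_def)
qed

text \<open>The matrix with rows \<open>(a, 1 - a\<^sup>2)\<close> and \<open>(1, - a)\<close>
  squares to the identity; \<open>unimodular n\<close> ensures that the entries of \<open>x\<close>
  are already reduced.\<close>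

lemma refl_act_involution:
  assumes "x \<in> unimodular n"
  shows "refl_act n (refl_act n x l) l = x"
proof -
  obtain x1 x2 x3 x4 where x: "x = ((x1, x2), (x3, x4))" by (metis surj_pair)
  define a where "a = 2 * int l"
  have 1: "(a * ((a * y + z) mod n) + ((1 - a\<^sup>2) * y - a * z) mod n) mod n = y mod n" for y z
  proof -
    have "(a * ((a * y + z) mod n) + ((1 - a\<^sup>2) * y - a * z) mod n) mod n
       = (a * (a * y + z) + ((1 - a\<^sup>2) * y - a * z)) mod n" unfolding cong_def[symmetric] by (intro cong_refl cong_add cong_diff cong_mult) simp_all
    also have "a * (a * y + z) + ((1 - a\<^sup>2) * y - a * z) = y"
      by (simp add: algebra_simps power2_eq_square)
    finally show ?thesis .
  qed
  have 2: "((1 - a\<^sup>2) * ((a * y + z) mod n) - a * (((1 - a\<^sup>2) * y - a * z) mod n)) mod n = z mod n" for y z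
  proof -
    have "((1 - a\<^sup>2) * ((a * y + z) mod n) - a * (((1 - a\<^sup>2) * y - a * z) mod n)) mod n
       = ((1 - a\<^sup>2) * (a * y + z) - a * ((1 - a\<^sup>2) * y - a * z)) mod n" unfolding cong_def[symmetric] by (intro cong_refl cong_add cong_diff cong_mult) simp_all
    also have "(1 - a\<^sup>2) * (a * y + z) - a * ((1 - a\<^sup>2) * y - a * z) = z"
      by (simp add: algebra_simps power2_eq_square)
    finally show ?thesis .
  qed
  show ?thesis using assms
    by (simp add: x refl_act_def Let_def a_def[symmetric] 1 2 unimodular_def)
qed

text \<open>The first column of \<open>x\<close> times the product of a word is \<open>x\<close>
  applied to \<open>word_vec ls\<close>; the girth argument works with this column alone.\<close>

lemma foldl_refl_act:
  assumes "foldl (refl_act n) ((x1, x2), (x3, x4)) ls = ((y1, y2), (y3, y4))"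
  shows "(y1 - (x1 * fst (word_vec ls) + x2 * snd (word_vec ls))) mod n = 0 \<and>
         (y3 - (x3 * fst (word_vec ls) + x4 * snd (word_vec ls))) mod n = 0"
  using assms
proof (induction ls arbitrary: x1 x2 x3 x4)
  case Nil
  then show ?case by simp
next
  case (Cons l ls)
  obtain p q where pq: "word_vec ls = (p, q)" by fastforce
  define a where "a = 2 * int l"
  have 1: "(y - ((a * z1 + z2) mod n * p + ((1 - a\<^sup>2) * z1 - a * z2) mod n * q)) mod n
      = (y - (z1 * (a * p + (1 - a\<^sup>2) * q) + z2 * (p - a * q))) mod n" for y z1 z2
  proof -
    have "(y - ((a * z1 + z2) mod n * p + ((1 - a\<^sup>2) * z1 - a * z2) mod n * q)) mod n
      = (y - ((a * z1 + z2) * p + ((1 - a\<^sup>2) * z1 - a * z2) * q)) mod n"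
      unfolding cong_def[symmetric] by (intro cong_refl cong_add cong_diff cong_mult) simp_all
    also have "(a * z1 + z2) * p + ((1 - a\<^sup>2) * z1 - a * z2) * q
      = z1 * (a * p + (1 - a\<^sup>2) * q) + z2 * (p - a * q)" by (simp add: algebra_simps)
    finally show ?thesis .
  qed
  have "foldl (refl_act n) (((a * x1 + x2) mod n, ((1 - a\<^sup>2) * x1 - a * x2) mod n),
        ((a * x3 + x4) mod n, ((1 - a\<^sup>2) * x3 - a * x4) mod n)) ls = ((y1, y2), (y3, y4))"
  proof -
    have "refl_act n ((x1, x2), (x3, x4)) l = (((a * x1 + x2) mod n, ((1 - a\<^sup>2) * x1 - a * x2) mod n),
        ((a * x3 + x4) mod n, ((1 - a\<^sup>2) * x3 - a * x4) mod n))"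
      by (simp add: refl_act_def Let_def a_def)
    then show ?thesis using Cons.prems by (simp only: foldl.simps)
  qed
  from Cons.IH[OF this] show ?case
    by (simp add: pq refl_vec_def Let_def a_def[symmetric] 1)
qed

text \<open>At a fixed point the first columns agree modulo \<open>n\<close>. Eliminating
  \<open>p\<close> leaves the determinant times \<open>q\<close>, so \<open>n dvd q\<close>; but
  ping-pong gives \<open>q \<noteq> 0\<close> and the entry bound
  \<open>\<bar>q\<bar> < n\<close>.\<close>

lemma foldl_refl_act_no_fixpoint:
  assumes x: "x \<in> unimodular n" and n: "n > (2 * int m + 1) ^ (2 * length ls)"
    and ls: "ls \<noteq> []" "distinct_adj ls" "\<forall>l\<in>set ls. l \<le> m"
  shows "foldl (refl_act n) x ls \<noteq> x"
proof
  assume fixed: "foldl (refl_act n) x ls = x"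
  obtain x1 x2 x3 x4 where xx: "x = ((x1, x2), (x3, x4))" by (metis surj_pair)
  obtain p q where pq: "word_vec ls = (p, q)" by fastforce
  have d: "n dvd x1 - (x1 * p + x2 * q)" "n dvd x3 - (x3 * p + x4 * q)"
    using foldl_refl_act[OF fixed[unfolded xx]] pq by auto
  have "n dvd x3 * (x1 - (x1 * p + x2 * q)) - x1 * (x3 - (x3 * p + x4 * q))"
    using dvd_mult[OF d(1)] dvd_mult[OF d(2)] by (rule dvd_diff)
  also have "\<dots> = (x1 * x4 - x2 * x3) * q" by (simp add: algebra_simps)
  finally have "n dvd (x1 * x4 - x2 * x3) * q" .
  moreover have "n dvd (x1 * x4 - x2 * x3) - 1 \<or> n dvd (x1 * x4 - x2 * x3) + 1"
    using x by (auto simp: xx unimodular_def mod_eq_dvd_iff)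
  ultimately have "n dvd q"
  proof (elim disjE)
    assume "n dvd (x1 * x4 - x2 * x3) * q" "n dvd (x1 * x4 - x2 * x3) - 1"
    then have "n dvd (x1 * x4 - x2 * x3) * q - ((x1 * x4 - x2 * x3) - 1) * q" by (intro dvd_diff) auto
    then show ?thesis by (simp add: algebra_simps)
  next
    assume "n dvd (x1 * x4 - x2 * x3) * q" "n dvd (x1 * x4 - x2 * x3) + 1"
    then have "n dvd ((x1 * x4 - x2 * x3) + 1) * q - (x1 * x4 - x2 * x3) * q" by (intro dvd_diff) auto
    then show ?thesis by (simp add: algebra_simps)
  qed
  moreover obtain k ks where "ls = k # ks" using ls(1) by (cases ls) auto
  then have "q \<noteq> 0" using word_vec_ping_pong[of k ks] ls(2) pq by auto
  moreover have "\<bar>q\<bar> < n" using word_vec_bound[OF ls(3)] pq n by auto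
  ultimately show False using zdvd_imp_le[of n "\<bar>q\<bar>"] by auto
qed

text \<open>The matrices are renumbered, and \<open>act x l\<close> is read as the other end of the
  edge of colour \<open>l\<close> at \<open>x\<close>.\<close>

lemma high_girth_involutions:
  fixes m R :: nat
  obtains N :: nat and act :: "nat \<Rightarrow> nat \<Rightarrow> nat" where
    "N > 0" "N \<le> ((2 * m + 1) ^ (2 * R) + 1) ^ 4"
    "\<And>x l. x < N \<Longrightarrow> act x l < N"
    "\<And>x l. x < N \<Longrightarrow> act (act x l) l = x"
    "\<And>x ls. x < N \<Longrightarrow> ls \<noteq> [] \<Longrightarrow> length ls \<le> R \<Longrightarrow> distinct_adj ls \<Longrightarrow>
       \<forall>l\<in>set ls. l \<le> m \<Longrightarrow> foldl act x ls \<noteq> x"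
proof -
  \<comment> \<open>Exceeds the entries of \<open>word_vec\<close> for all words of length at most
    \<open>R\<close> with letters up to \<open>m\<close>.\<close>
  define n :: nat where "n = (2 * m + 1) ^ (2 * R) + 1"
  define U where "U = unimodular (int n)"
  have n: "int n > 0" "n > 1" by (simp_all add: n_def del: of_nat_add of_nat_Suc)
  have sub: "U \<subseteq> ({0..<int n} \<times> {0..<int n}) \<times> ({0..<int n} \<times> {0..<int n})"
    by (auto simp: U_def unimodular_def)
  then have fin: "finite U" by (rule finite_subset) auto
  have "card U \<le> n ^ 4" using card_mono[OF _ sub] by (auto simp: card_cartesian_product power4_eq_xxxx mult.assoc)
  moreover have "((1, 0), (0, 1)) \<in> U" using n by (auto simp: U_def unimodular_def)
  then have "card U > 0" using fin by (auto simp: card_gt_0_iff)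
  moreover obtain f where f: "bij_betw f {0..<card U} U" using ex_bij_betw_nat_finite[OF fin] by blast
  define g where "g = the_inv_into {0..<card U} f"
  define act where "act x l = g (refl_act (int n) (f x) l)" for x l
  have fU: "f x \<in> U" if "x < card U" for x using bij_betwE[OF f] that by auto
  have gU: "g u < card U" "f (g u) = u" if "u \<in> U" for u
    using f that bij_betw_the_inv_into[OF f] unfolding g_def
    by (auto simp: bij_betw_def f_the_inv_into_f)
  have gf: "g (f x) = x" if "x < card U" for x
    using f that unfolding g_def by (auto simp: bij_betw_def the_inv_into_f_f)
  have clos: "refl_act (int n) u l \<in> U" if "u \<in> U" for u l
    using refl_act_unimodular[OF n(1)] that by (auto simp: U_def)
  have a1: "act x l < card U" if "x < card U" for x l
    using that by (auto simp: act_def intro!: gU clos fU)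
  have a2: "act (act x l) l = x" if "x < card U" for x l
    using that fU[OF that] gU clos
    by (auto simp: act_def gf U_def[symmetric] refl_act_involution[of _ "int n", folded U_def])
  have fold: "f (foldl act x ls) = foldl (refl_act (int n)) (f x) ls \<and> foldl act x ls < card U"
    if "x < card U" for x ls
    using that
  proof (induction ls arbitrary: x)
    case (Cons l ls)
    have "f (act x l) = refl_act (int n) (f x) l" using Cons.prems by (auto simp: act_def gU clos fU)
    then show ?case using Cons.IH[OF a1[OF Cons.prems]] by simp
  qed auto
  have a3: "foldl act x ls \<noteq> x" if "x < card U" "ls \<noteq> []" "length ls \<le> R" "distinct_adj ls"
     "\<forall>l\<in>set ls. l \<le> m" for x ls
  proof -
    have "(2 * int m + 1) ^ (2 * length ls) \<le> (2 * int m + 1) ^ (2 * R)"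
      using that by (intro power_increasing) auto
    also have "\<dots> < int n" by (simp add: n_def add.commute)
    finally have "foldl (refl_act (int n)) (f x) ls \<noteq> f x"
      using that fU by (intro foldl_refl_act_no_fixpoint) (auto simp: U_def)
    then show ?thesis using fold[OF that(1)] by metis
  qed
  show ?thesis using calculation a1 a2 a3 by (intro that[of "card U" act]) (auto simp: n_def)
qed

section \<open>Nested gadgets\<close>

text \<open>Words that become empty when equal neighbours are cancelled, each letter being its own
  inverse. The bracket form exhibits the partner of the first letter, where a walk can be
  cut.\<close>

inductive cancelling :: "'a list \<Rightarrow> bool" where
  Nil: "cancelling []"
| pair: "cancelling u \<Longrightarrow> cancelling v \<Longrightarrow> cancelling (l # u @ l # v)"

lemma cancelling_insert: "cancelling w \<Longrightarrow> w = u @ v \<Longrightarrow> cancelling (u @ l # l # v)"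
proof (induction arbitrary: u v rule: cancelling.induct)
  case Nil
  then show ?case using cancelling.pair[OF cancelling.Nil cancelling.Nil, of l] by simp
next
  case (pair s t a)
  show ?case
  proof (cases u)
    case Nil
    then show ?thesis using cancelling.pair[OF cancelling.Nil cancelling.pair[OF pair.hyps], of l a] pair.prems
      by simp
  next
    case (Cons a' u')
    then have *: "a' = a" "s @ a # t = u' @ v" using pair.prems by auto
    from *(2) consider us where "u' = s @ us" "a # t = us @ v" | us where "s = u' @ us" "v = us @ a # t"
      by (auto simp: append_eq_append_conv2)
    then show ?thesis
    proof cases
      case 1
      show ?thesis
      proof (cases us)
        case Nil
        then show ?thesis using 1 * Cons cancelling.pair[OF pair.IH(1)[of s "[]"] pair.hyps(2), of a] by simp
      next
        case (Cons b us')
        then show ?thesis using 1 * \<open>u = a' # u'\<close> cancelling.pair[OF pair.hyps(1) pair.IH(2)[of us' v], of a]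
          by simp
      qed
    next
      case 2
      then show ?thesis using * Cons cancelling.pair[OF pair.IH(1)[of u' us] pair.hyps(2), of a] by simp
    qed
  qed
qed

lemma not_distinct_adjE:
  assumes "\<not> distinct_adj w"
  obtains u l v where "w = u @ l # l # v"
proof -
  have "\<exists>u l v. w = u @ l # l # v" using assms
  proof (induction w rule: induct_list012)
    case (3 x y zs)
    show ?case
    proof (cases "x = y")
      case True
      then show ?thesis by (intro exI[of _ "[]"]) auto
    next
      case False
      then have "\<not> distinct_adj (y # zs)" using 3(3) by simp
      then obtain u l v where "y # zs = u @ l # l # v" using 3(2) by blast
      then show ?thesis by (intro exI[of _ "x # u"]) auto
    qed
  qed auto
  then show ?thesis using that by blast
qed

section \<open>Gadget sizes and the numbering of virtual edges\<close>

definition width :: "nat \<Rightarrow> nat \<Rightarrow> nat" where "width c d = 2 ^ (c * 4 ^ d)"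

text \<open>The successor leaves index 0 to the hub terminals, which form no session.\<close>

definition slot :: "nat \<Rightarrow> nat \<Rightarrow> nat" where "slot p q = Suc (prod_encode (p, q))"

lemma slot_inject [simp]: "slot p q = slot p' q' \<longleftrightarrow> p = p' \<and> q = q'"
  by (simp add: slot_def)

lemma prod_encode_le: "p \<le> n \<Longrightarrow> q \<le> n \<Longrightarrow> prod_encode (p, q) \<le> 2 * n * n + 2 * n"
proof -
  assume *: "p \<le> n" "q \<le> n"
  have "triangle (p + q) \<le> (2 * n) * Suc (2 * n) div 2"
    unfolding triangle_def using * by (intro div_le_mono mult_le_mono) auto
  also have "\<dots> = 2 * n * n + n" by simp
  finally show ?thesis using * by (simp add: prod_encode_def)
qed

text \<open>Pairing is quadratic, whereas the width is raised to the fourth power from one depth to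
  the next; \<open>c \<ge> 2\<close> makes \<open>n \<ge> 4\<close>, which absorbs the
  constants.\<close>

lemma slot_le:
  assumes "c \<ge> 2" "p \<le> width c d" "q \<le> width c d"
  shows "slot p q \<le> width c (Suc d)"
proof -
  define n where "n = width c d"
  have n: "n \<ge> 4"
  proof -
    have "c * 1 \<le> c * 4 ^ d" by (intro mult_left_mono) auto
    then have "2 \<le> c * 4 ^ d" using assms(1) by linarith
    then have "(2::nat) ^ 2 \<le> n" unfolding n_def width_def by (intro power_increasing) auto
    then show ?thesis by simp
  qed
  have "slot p q \<le> 2 * n * n + 2 * n + 1"
    using prod_encode_le[of p n q] assms by (simp add: slot_def n_def)
  also have "\<dots> \<le> n ^ 4"
  proof -
    have "2 * n * n + 2 * n + 1 \<le> 2 * (n * n) + n * n + n * n" using n mult_le_mono[of 4 n n n] by linarith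
    also have "\<dots> = 4 * (n * n)" by simp
    also have "\<dots> \<le> (n * n) * (n * n)" using n mult_le_mono[of 4 n 1 n] by (intro mult_right_mono) auto
    finally show ?thesis by (simp add: power4_eq_xxxx mult.assoc)
  qed
  also have "n ^ 4 = width c (Suc d)"
    by (simp add: n_def width_def power_mult[symmetric] mult.assoc mult.commute[of 4])
  finally show ?thesis .
qed

section \<open>The tower of gadgets, its walks and their prices\<close>

type_synonym place = "nat \<times> bool \<times> nat"
type_synonym tower_vertex = "nat \<times> place"

text \<open>
  The vertex (x, d, True, i) is the source terminal s_i, and (x, d, False, i) the sink terminal t_i, of the
  gadget number x at depth d.  For p \<noteq> q the gadget needs a virtual edge from s_p to t_q: it is
  the session slot p q of a gadget at depth d + 1, and act selects that gadget.  The hub terminals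
  t_0 and s_0 are joined by the bottleneck edge of the gadget.
\<close>

locale tower =
  fixes h c m N :: nat and act :: "nat \<Rightarrow> nat \<Rightarrow> nat"
  assumes N_pos: "N > 0" and c: "c \<ge> 2"
    and act_less: "x < N \<Longrightarrow> act x l < N"
    and act_act: "x < N \<Longrightarrow> act (act x l) l = x"
    and girth: "x < N \<Longrightarrow> ls \<noteq> [] \<Longrightarrow> length ls \<le> 3 ^ h \<Longrightarrow> distinct_adj ls \<Longrightarrow>
       \<forall>l\<in>set ls. l \<le> m \<Longrightarrow> foldl act x ls \<noteq> x"
    and letter_le: "d < h \<Longrightarrow> e \<le> width c h \<Longrightarrow> prod_encode (d, e) \<le> m"
begin

lemma width_mono: "d \<le> d' \<Longrightarrow> width c d \<le> width c d'"
  unfolding width_def by (intro power_increasing mult_left_mono) auto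

text \<open>A step between depths with gadget numbers forgotten. The colour does not record the side
  \<open>b\<close>: both ends of a virtual edge lead to the same gadget.\<close>

inductive connector :: "nat \<Rightarrow> place \<Rightarrow> place \<Rightarrow> bool" where
  down: "d < h \<Longrightarrow> p \<le> width c d \<Longrightarrow> q \<le> width c d \<Longrightarrow> p \<noteq> q \<Longrightarrow>
    connector (prod_encode (d, slot p q)) (d, b, if b then p else q) (Suc d, b, slot p q)"
| up: "d < h \<Longrightarrow> p \<le> width c d \<Longrightarrow> q \<le> width c d \<Longrightarrow> p \<noteq> q \<Longrightarrow>
    connector (prod_encode (d, slot p q)) (Suc d, b, slot p q) (d, b, if b then p else q)"

lemma connector_letter: "connector l P P' \<Longrightarrow> l \<le> m"
proof -
  have "prod_encode (d, slot p q) \<le> m" if "d < h" "p \<le> width c d" "q \<le> width c d" for d p q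
    using letter_le[OF that(1)] order_trans[OF slot_le[OF c that(2,3)] width_mono[of "Suc d" h]] that(1) by simp
  then show "connector l P P' \<Longrightarrow> l \<le> m" by (auto elim!: connector.cases)
qed

text \<open>A \<open>bottom\<close> step stays within its gadget, so it counts towards the length
  but adds no letter.\<close>

inductive walk :: "place \<Rightarrow> nat list \<Rightarrow> nat \<Rightarrow> place \<Rightarrow> bool" where
  Nil: "walk P [] 0 P"
| bottom: "walk (h, \<not> b, i) w n Q \<Longrightarrow> walk (h, b, i) w (Suc n) Q"
| step: "connector l P P' \<Longrightarrow> walk P' w n Q \<Longrightarrow> walk P (l # w) (Suc n) Q"

lemma walk_Cons:
  "walk P w n Q \<Longrightarrow> w = l # w' \<Longrightarrow>
   \<exists>P0 P1 n0 n1. walk P [] n0 P0 \<and> connector l P0 P1 \<and> walk P1 w' n1 Q \<and> n = n0 + 1 + n1"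
proof (induction rule: walk.induct)
  case (bottom b i w n Q)
  then obtain P0 P1 n0 n1 where "walk (h, \<not> b, i) [] n0 P0" "connector l P0 P1" "walk P1 w' n1 Q" "n = n0 + 1 + n1"
    by auto
  then have "walk (h, b, i) [] (Suc n0) P0 \<and> connector l P0 P1 \<and> walk P1 w' n1 Q \<and> Suc n = Suc n0 + 1 + n1"
    using walk.bottom by auto
  then show ?case by blast
next
  case (step l' P P' w n Q)
  then have "walk P [] 0 P \<and> connector l P P' \<and> walk P' w' n Q \<and> Suc n = 0 + 1 + n"
    by (auto intro: walk.Nil)
  then show ?case by blast
qed simp

lemma walk_append:
  "walk P w n Q \<Longrightarrow> w = u @ v \<Longrightarrow> \<exists>R n0 n1. walk P u n0 R \<and> walk R v n1 Q \<and> n = n0 + n1"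
proof (induction arbitrary: u rule: walk.induct)
  case (Nil P)
  then have "walk P u 0 P \<and> walk P v 0 P \<and> (0::nat) = 0 + 0" by (auto intro: walk.Nil)
  then show ?case by blast
next
  case (bottom b i w n Q)
  then obtain R n0 n1 where "walk (h, \<not> b, i) u n0 R" "walk R v n1 Q" "n = n0 + n1" by blast
  then have "walk (h, b, i) u (Suc n0) R \<and> walk R v n1 Q \<and> Suc n = Suc n0 + n1"
    using walk.bottom by auto
  then show ?case by blast
next
  case (step l P P' w n Q)
  show ?case
  proof (cases u)
    case Nil
    then have "walk P u 0 P \<and> walk P v (Suc n) Q \<and> Suc n = 0 + Suc n"
      using walk.step[OF step.hyps] step.prems by (auto intro: walk.Nil)
    then show ?thesis by blast
  next
    case (Cons a u')
    then obtain R n0 n1 where "walk P' u' n0 R" "walk R v n1 Q" "n = n0 + n1" using step by auto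
    then have "walk P u (Suc n0) R \<and> walk R v n1 Q \<and> Suc n = Suc n0 + n1"
      using walk.step[OF step.hyps(1), of u' n0 R] Cons step.prems by auto
    then show ?thesis by blast
  qed
qed

text \<open>
  The metric of the complete bipartite graph on the terminals s_i, t_j without the matching
  edges between s_i and t_i.
\<close>

definition hops :: "bool \<times> nat \<Rightarrow> bool \<times> nat \<Rightarrow> nat" where
  "hops P Q = (if fst P = fst Q then if snd P = snd Q then 0 else 2 else if snd P = snd Q then 3 else 1)"

lemma hops_triangle: "hops P R \<le> hops P Q + hops Q R"
  by (auto simp: hops_def)

text \<open>A hop at depth \<open>d\<close> is worth a third of \<open>3 ^ (h - d)\<close> steps;
  the factor 3 on the right avoids fractions. The three hops of a session at depth
  \<open>d + 1\<close> thus weigh as much as one hop at depth \<open>d\<close>.\<close>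

definition priced :: "place \<Rightarrow> nat \<Rightarrow> place \<Rightarrow> bool" where
  "priced P n Q \<longleftrightarrow> fst Q = fst P \<and> 3 ^ (h - fst P) * hops (snd P) (snd Q) \<le> 3 * n"

lemma priced_trans:
  assumes "priced P n Q" "priced Q n' R"
  shows "priced P (n + n') R"
proof -
  have "3 ^ (h - fst P) * hops (snd P) (snd R) \<le> 3 ^ (h - fst P) * (hops (snd P) (snd Q) + hops (snd Q) (snd R))"
    by (intro mult_left_mono hops_triangle) auto
  then show ?thesis using assms by (auto simp: priced_def algebra_simps)
qed

text \<open>Equal colours force the same slot on the way back, so the excursion ends where it began
  or at the other end of the virtual edge. In the latter case three hops of the deeper level balance
  one hop of the upper, whether the excursion leads down or up.\<close>

lemma priced_connectors:
  assumes "connector l P P1" "priced P1 n P2" "connector l P2 P3"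
  shows "priced P (n + 2) P3"
  using assms(1)
proof cases
  case (down d p q b)
  obtain d2 b2 i2 where P2: "P2 = (d2, b2, i2)" by (metis surj_pair)
  have d2: "d2 = Suc d" using assms(2) down P2 by (simp add: priced_def)
  have P3: "i2 = slot p q" "P3 = (d, b2, if b2 then p else q)"
    using assms(3) unfolding down P2 d2 by (auto elim!: connector.cases)
  have "3 ^ (h - d) = (3::nat) * 3 ^ (h - Suc d)" using down(4) by (simp add: Suc_diff_Suc flip: power_Suc)
  then show ?thesis
    using assms(2) down(2,3,7) P2 d2 P3 by (cases "b = b2") (auto simp: priced_def hops_def)
next
  case (up d p q b)
  obtain d2 b2 i2 where P2: "P2 = (d2, b2, i2)" by (metis surj_pair)
  have d2: "d2 = d" using assms(2) up P2 by (simp add: priced_def)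
  have P3: "i2 = (if b2 then p else q)" "P3 = (Suc d, b2, slot p q)"
    using assms(3) unfolding up P2 d2 by (auto elim!: connector.cases)
  have "3 ^ (h - d) = (3::nat) * 3 ^ (h - Suc d)" using up(4) by (simp add: Suc_diff_Suc flip: power_Suc)
  then show ?thesis
    using assms(2) up(2,3,7) P2 d2 P3 by (cases "b = b2") (auto simp: priced_def hops_def split: if_splits)
qed

lemma priced_Nil: "walk P w n Q \<Longrightarrow> w = [] \<Longrightarrow> priced P n Q"
proof (induction rule: walk.induct)
  case (bottom b i w n Q)
  have "priced (h, b, i) 1 (h, \<not> b, i)" by (simp add: priced_def hops_def)
  with bottom show ?case using priced_trans by fastforce
qed (auto simp: priced_def hops_def)

text \<open>The walk is cut at the two partner letters: the inner word prices an excursion,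
  \<open>priced_connectors\<close> wraps it, and the triangle inequality chains the pieces.\<close>

lemma priced_cancelling: "cancelling w \<Longrightarrow> walk P w n Q \<Longrightarrow> priced P n Q"
proof (induction w arbitrary: P n Q rule: cancelling.induct)
  case Nil
  then show ?case using priced_Nil by blast
next
  case (pair u v l)
  obtain P0 P1 n0 n1 where 1: "walk P [] n0 P0" "connector l P0 P1" "walk P1 (u @ l # v) n1 Q" "n = n0 + 1 + n1"
    using walk_Cons[OF pair.prems refl] by blast
  obtain R m0 m1 where 2: "walk P1 u m0 R" "walk R (l # v) m1 Q" "n1 = m0 + m1"
    using walk_append[OF 1(3) refl] by blast
  obtain R0 R1 k0 k1 where 3: "walk R [] k0 R0" "connector l R0 R1" "walk R1 v k1 Q" "m1 = k0 + 1 + k1"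
    using walk_Cons[OF 2(2) refl] by blast
  have "priced P1 (m0 + k0) R0" using priced_trans pair.IH(1)[OF 2(1)] priced_Nil[OF 3(1)] by blast
  then have "priced P0 (m0 + k0 + 2) R1" using priced_connectors 1(2) 3(2) by blast
  then have "priced P (n0 + (m0 + k0 + 2) + k1) Q"
    using priced_trans priced_Nil[OF 1(1)] pair.IH(2)[OF 3(3)] by blast
  then show ?case using 1(4) 2(3) 3(4) by (simp add: algebra_simps)
qed

lemma foldl_act_less: "x < N \<Longrightarrow> foldl act x w < N"
  by (induction w arbitrary: x) (auto simp: act_less)

text \<open>Within the girth bound, a nonempty closed word has two equal neighbours. Deleting them
  keeps it closed because \<open>act\<close> is involutory, and \<open>cancelling_insert\<close>
  puts them back.\<close>

lemma closed_word_cancelling: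
  assumes "x < N" "foldl act x w = x" "length w \<le> 3 ^ h" "\<forall>l\<in>set w. l \<le> m"
  shows "cancelling w"
  using assms(2-4)
proof (induction w rule: length_induct)
  case (1 w)
  show ?case
  proof (cases "w = []")
    case False
    then have "\<not> distinct_adj w" using girth[OF assms(1) False] 1 by blast
    then obtain u l v where w: "w = u @ l # l # v" by (rule not_distinct_adjE)
    have "foldl act x (u @ v) = x" using 1(2) act_act[OF foldl_act_less[OF assms(1)]] by (simp add: w)
    then have "cancelling (u @ v)" using 1 by (auto simp: w)
    then show ?thesis unfolding w by (rule cancelling_insert) simp
  qed (simp add: cancelling.Nil)
qed

text \<open>All arcs but the bottlenecks. As \<open>act\<close> is involutory, each slot of a gadget
  at depth \<open>Suc d\<close> serves exactly one gadget at depth \<open>d\<close>.\<close>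

inductive_set links :: "(tower_vertex \<times> tower_vertex) set" where
  bottom: "x < N \<Longrightarrow> i \<le> width c h \<Longrightarrow> ((x, h, b, i), (x, h, \<not> b, i)) \<in> links"
| down: "x < N \<Longrightarrow> d < h \<Longrightarrow> p \<le> width c d \<Longrightarrow> q \<le> width c d \<Longrightarrow> p \<noteq> q \<Longrightarrow>
    ((x, d, b, if b then p else q), (act x (prod_encode (d, slot p q)), Suc d, b, slot p q)) \<in> links"
| up: "x < N \<Longrightarrow> d < h \<Longrightarrow> p \<le> width c d \<Longrightarrow> q \<le> width c d \<Longrightarrow> p \<noteq> q \<Longrightarrow>
    ((act x (prod_encode (d, slot p q)), Suc d, b, slot p q), (x, d, b, if b then p else q)) \<in> links"

lemma links_connector:
  "((x, d, b, i), (x', d', b', i')) \<in> links \<Longrightarrow>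
    x < N \<and> x' < N \<and> (d = h \<and> d' = h \<and> x' = x \<and> i' = i \<and> b' = (\<not> b) \<or>
     (\<exists>l. connector l (d, b, i) (d', b', i') \<and> x' = act x l))"
proof (induction rule: links.induct)
  case (down x d p q b)
  then show ?case using connector.down[of d p q b] act_less by blast
next
  case (up x d p q b)
  then show ?case using connector.up[of d p q b] act_less act_act by metis
qed auto

lemma links_walk:
  assumes "((x, P), (y, Q)) \<in> links ^^ n"
  shows "\<exists>w. walk P w n Q \<and> (x < N \<longrightarrow> foldl act x w = y) \<and> length w \<le> n \<and> (\<forall>l\<in>set w. l \<le> m)"
  using assms
proof (induction n arbitrary: x P)
  case 0
  then show ?case by (auto intro: walk.Nil)
next
  case (Suc n)
  then obtain x' P' where s: "((x, P), (x', P')) \<in> links" "((x', P'), (y, Q)) \<in> links ^^ n"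
    by (metis relpow_Suc_D2 surj_pair)
  from Suc.IH[OF s(2)] obtain w where w: "walk P' w n Q" "x' < N \<longrightarrow> foldl act x' w = y" "length w \<le> n"
    "\<forall>l\<in>set w. l \<le> m" by blast
  obtain d1 b1 i1 d2 b2 i2 where PP: "P = (d1, b1, i1)" "P' = (d2, b2, i2)" by (metis surj_pair)
  consider b i where "P = (h, b, i)" "P' = (h, \<not> b, i)" "x' = x"
    | l where "connector l P P'" "x' = act x l"
    using links_connector[OF s(1)[unfolded PP]] PP by blast
  then show ?case
  proof cases
    case 1
    then show ?thesis using w walk.bottom[of b i w n Q] by (intro exI[of _ w]) auto
  next
    case 2
    then show ?thesis using w walk.step[OF 2(1) w(1)] act_less connector_letter[OF 2(1)]
      by (intro exI[of _ "l # w"]) auto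
  qed
qed

text \<open>A shorter walk returns to gadget \<open>x\<close>, so its word cancels; but three hops
  at depth 0 are priced at \<open>3 ^ h\<close> steps.\<close>

theorem links_distance:
  assumes "x < N" "((x, 0, True, i), (x, 0, False, i)) \<in> links ^^ n"
  shows "n \<ge> 3 ^ h"
proof (rule ccontr)
  assume n: "\<not> n \<ge> 3 ^ h"
  obtain w where w: "walk (0, True, i) w n (0, False, i)" "foldl act x w = x" "length w \<le> n" "\<forall>l\<in>set w. l \<le> m"
    using links_walk[OF assms(2)] assms(1) by blast
  then have "cancelling w" using closed_word_cancelling[OF assms(1)] n by auto
  from priced_cancelling[OF this w(1)] show False using n by (simp add: priced_def hops_def)
qed

end

section \<open>Coding on nested gadgets\<close>

lemma knows_append: "knows A S F u \<phi> \<Longrightarrow> knows A S (F @ G) u \<phi>"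
proof -
  assume *: "knows A S F u \<phi>"
  show ?thesis unfolding knows_def
  proof (intro allI impI)
    fix x y
    assume 1: "\<forall>i<length S. S ! i = u \<longrightarrow> x i = y i"
      and 2: "\<forall>r<length (F @ G). \<forall>v. (v, u) \<in> A \<longrightarrow> ((F @ G) ! r) (v, u) x = ((F @ G) ! r) (v, u) y"
    have "(F ! r) (v, u) x = (F ! r) (v, u) y" if "r < length F" "(v, u) \<in> A" for r v
      using spec[OF 2, of r] that by (simp add: nth_append)
    then show "\<phi> x = \<phi> y" using * 1 unfolding knows_def by blast
  qed
qed

lemma knows_received: "(v, u) \<in> A \<Longrightarrow> knows A S (F @ [m]) u (m (v, u))"
  unfolding knows_def by (metis length_append_singleton lessI nth_append_length)

lemma knows_const [simp]: "knows A S F u (\<lambda>_. b)"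
  by (simp add: knows_def)

lemma knows_source: "i < length S \<Longrightarrow> S ! i = u \<Longrightarrow> knows A S F u (\<lambda>x. x i)"
  by (simp add: knows_def)

lemma knows_determined:
  assumes "\<And>i. i \<in> I \<Longrightarrow> knows A S F u (f i)"
    and "\<And>x y. (\<And>i. i \<in> I \<Longrightarrow> f i x = f i y) \<Longrightarrow> \<phi> x = \<phi> y"
  shows "knows A S F u \<phi>"
  unfolding knows_def
proof (intro allI impI)
  fix x y
  assume 1: "\<forall>i<length S. S ! i = u \<longrightarrow> x i = y i"
    and 2: "\<forall>r<length F. \<forall>v. (v, u) \<in> A \<longrightarrow> (F ! r) (v, u) x = (F ! r) (v, u) y"
  have "f i x = f i y" if "i \<in> I" for i
    using assms(1)[OF that] 1 2 unfolding knows_def by blast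
  then show "\<phi> x = \<phi> y" by (rule assms(2))
qed

text \<open>The sum of the bits over the two-element field, which is the symbol sent over a
  bottleneck.\<close>

definition parity :: "nat set \<Rightarrow> (nat \<Rightarrow> 'x \<Rightarrow> bool) \<Rightarrow> 'x \<Rightarrow> bool" where
  "parity I f x \<longleftrightarrow> odd (card {i \<in> I. f i x})"

lemma parity_cancel:
  assumes "finite I" "j \<in> I" "parity I f x = parity I f y"
    and "\<And>i. i \<in> I \<Longrightarrow> i \<noteq> j \<Longrightarrow> f i x = f i y"
  shows "f j x = f j y"
proof -
  have split: "parity I f z \<longleftrightarrow> (f j z \<noteq> odd (card {i \<in> I - {j}. f i z}))" for z
  proof (cases "f j z")
    case True
    then have "{i \<in> I. f i z} = insert j {i \<in> I - {j}. f i z}" using assms(2) by auto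
    then show ?thesis using True assms(1) by (simp add: parity_def)
  next
    case False
    then have "{i \<in> I. f i z} = {i \<in> I - {j}. f i z}" by auto
    then show ?thesis using False by (simp add: parity_def)
  qed
  have "{i \<in> I - {j}. f i x} = {i \<in> I - {j}. f i y}" using assms(4) by auto
  then show ?thesis using split[of x] split[of y] assms(3) by auto
qed

section \<open>Delivery through the tower, depth by depth\<close>

context tower
begin

text \<open>Depth \<open>h\<close> has no bottlenecks: a session there is a direct link.\<close>

inductive_set necks :: "(tower_vertex \<times> tower_vertex) set" where
  "x < N \<Longrightarrow> d < h \<Longrightarrow> ((x, d, b, 0), (x, d, \<not> b, 0)) \<in> necks"

abbreviation arcs :: "(tower_vertex \<times> tower_vertex) set" where "arcs \<equiv> links \<union> necks"

lemma arcs_cases: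
  assumes "((x, d, b, i), (x', d', b', i')) \<in> arcs"
  obtains (bottom) "d = h" "d' = h" "x' = x" "b' = (\<not> b)" "i' = i" "x < N" "i \<le> width c h"
  | (down) p q where "x < N" "d < h" "p \<le> width c d" "q \<le> width c d" "p \<noteq> q"
      "x' = act x (prod_encode (d, slot p q))" "d' = Suc d" "b' = b" "i = (if b then p else q)" "i' = slot p q"
  | (up) p q where "x' < N" "d' < h" "p \<le> width c d'" "q \<le> width c d'" "p \<noteq> q"
      "x = act x' (prod_encode (d', slot p q))" "d = Suc d'" "b' = b" "i' = (if b then p else q)" "i = slot p q"
  | (neck) "x < N" "d < h" "x' = x" "d' = d" "b' = (\<not> b)" "i = 0" "i' = 0"
proof -
  have "((x, d, b, i), (x', d', b', i')) \<in> links \<Longrightarrow>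
     (d = h \<and> d' = h \<and> x' = x \<and> b' = (\<not> b) \<and> i' = i \<and> x < N \<and> i \<le> width c h) \<or>
     (\<exists>p q. x < N \<and> d < h \<and> p \<le> width c d \<and> q \<le> width c d \<and> p \<noteq> q \<and>
      x' = act x (prod_encode (d, slot p q)) \<and> d' = Suc d \<and> b' = b \<and> i = (if b then p else q) \<and> i' = slot p q) \<or>
     (\<exists>p q. x' < N \<and> d' < h \<and> p \<le> width c d' \<and> q \<le> width c d' \<and> p \<noteq> q \<and>
      x = act x' (prod_encode (d', slot p q)) \<and> d = Suc d' \<and> b' = b \<and> i' = (if b then p else q) \<and> i = slot p q)"
    by (induction rule: links.induct) blast+
  moreover have "((x, d, b, i), (x', d', b', i')) \<in> necks \<Longrightarrow>
     x < N \<and> d < h \<and> x' = x \<and> d' = d \<and> b' = (\<not> b) \<and> i = 0 \<and> i' = 0"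
    by (induction rule: necks.induct) auto
  ultimately show ?thesis using assms bottom down up neck by blast
qed

definition unslot :: "nat \<Rightarrow> nat \<times> nat" where "unslot e = prod_decode (e - 1)"

lemma unslot_slot [simp]: "unslot (slot p q) = (p, q)"
  by (simp add: unslot_def slot_def)

lemma slot_pos: "1 \<le> slot p q"
  by (simp add: slot_def)

text \<open>Quantifying over the past \<open>F\<close> and the symbols \<open>y\<close> lets the
  depth above call the service twice in succession, with different symbols.\<close>

definition delivers :: "nat \<Rightarrow> nat \<Rightarrow> bool" where
  "delivers d t \<longleftrightarrow> (\<forall>S F y. transcript arcs S F \<longrightarrow>
     (\<forall>x<N. \<forall>i\<in>{1..width c d}. knows arcs S F (x, d, True, i) (y x i)) \<longrightarrow>
     (\<exists>G. length G = t \<and> transcript arcs S (F @ G) \<and>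
        (\<forall>x<N. \<forall>i\<in>{1..width c d}. knows arcs S (F @ G) (x, d, False, i) (y x i))))"

lemma deliversD:
  assumes "delivers d t" "transcript arcs S F"
    "\<And>x i. x < N \<Longrightarrow> 1 \<le> i \<Longrightarrow> i \<le> width c d \<Longrightarrow> knows arcs S F (x, d, True, i) (y x i)"
  obtains G where "length G = t" "transcript arcs S (F @ G)"
    "\<And>x i. x < N \<Longrightarrow> 1 \<le> i \<Longrightarrow> i \<le> width c d \<Longrightarrow> knows arcs S (F @ G) (x, d, False, i) (y x i)"
  using assms unfolding delivers_def by (metis atLeastAtMost_iff)

lemma delivers_bottom: "delivers h 1"
  unfolding delivers_def
proof (intro allI impI)
  fix S F y
  assume F: "transcript arcs S F"
    and y: "\<forall>x<N. \<forall>i\<in>{1..width c h}. knows arcs S F (x, h, True, i) (y x i :: (nat \<Rightarrow> bool) \<Rightarrow> bool)"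
  define m :: "tower_vertex \<times> tower_vertex \<Rightarrow> (nat \<Rightarrow> bool) \<Rightarrow> bool" where
    "m = (\<lambda>((x, d, b, i), v). if x < N \<and> d = h \<and> b \<and> i \<in> {1..width c h} then y x i else (\<lambda>_. False))"
  have "knows arcs S F u (m (u, v))" for u v
    using y by (cases u) (auto simp: m_def)
  then have "transcript arcs S (F @ [m])" using F by (intro transcript.snoc) auto
  moreover have "knows arcs S (F @ [m]) (x, h, False, i) (y x i)" if "x < N" "i \<in> {1..width c h}" for x i
  proof -
    have "((x, h, True, i), (x, h, False, i)) \<in> arcs" using links.bottom[of x i True] that by simp
    from knows_received[OF this, of S F m] show ?thesis using that by (simp add: m_def)
  qed
  ultimately show "\<exists>G. length G = 1 \<and> transcript arcs S (F @ G) \<and>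
        (\<forall>x<N. \<forall>i\<in>{1..width c h}. knows arcs S (F @ G) (x, h, False, i) (y x i))"
    by (intro exI[of _ "[m]"]) auto
qed

text \<open>One round down, \<open>t\<close> rounds of delivery at the next depth, one round up, for
  all gadgets of depth \<open>d\<close> in parallel.\<close>

lemma cross_virtual_edges:
  assumes IH: "delivers (Suc d) t" and d: "d < h" and F: "transcript arcs S F"
    and z: "\<And>x p. x < N \<Longrightarrow> p \<le> width c d \<Longrightarrow> knows arcs S F (x, d, True, p) (z x p)"
  obtains G where "length G = t + 2" "transcript arcs S (F @ G)"
    "\<And>x p q. x < N \<Longrightarrow> p \<le> width c d \<Longrightarrow> q \<le> width c d \<Longrightarrow> p \<noteq> q \<Longrightarrow>
       knows arcs S (F @ G) (x, d, False, q) (z x p)"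
proof -
  define m1 :: "tower_vertex \<times> tower_vertex \<Rightarrow> (nat \<Rightarrow> bool) \<Rightarrow> bool" where
    "m1 = (\<lambda>((x, d', b, i), v). if x < N \<and> d' = d \<and> b \<and> i \<le> width c d then z x i else (\<lambda>_. False))"
  have "knows arcs S F u (m1 (u, v))" for u v
    using z by (cases u) (auto simp: m1_def)
  then have F1: "transcript arcs S (F @ [m1])" using F by (intro transcript.snoc) auto
  \<comment> \<open>The gadget served by slot \<open>e\<close> of \<open>x'\<close> is found by
    applying \<open>act\<close> once more. Indices that encode no virtual edge carry a
    constant.\<close>
  define y where "y x' e = (let (p, q) = unslot e in
     if e = slot p q \<and> p \<le> width c d \<and> q \<le> width c d \<and> p \<noteq> q then z (act x' (prod_encode (d, e))) p else (\<lambda>_. False))"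
    for x' e
  have y_known: "knows arcs S (F @ [m1]) (x', Suc d, True, e) (y x' e)" if "x' < N" for x' e
  proof -
    obtain p q where pq: "unslot e = (p, q)" by fastforce
    show ?thesis
    proof (cases "e = slot p q \<and> p \<le> width c d \<and> q \<le> width c d \<and> p \<noteq> q")
      case True
      define x where "x = act x' (prod_encode (d, e))"
      have x: "x < N" "act x (prod_encode (d, e)) = x'" using that by (auto simp: x_def act_less act_act)
      have "((x, d, True, p), (x', Suc d, True, e)) \<in> arcs"
        using links.down[of x d p q True] True x d by simp
      from knows_received[OF this, of S F m1]
      have "knows arcs S (F @ [m1]) (x', Suc d, True, e) (m1 ((x, d, True, p), (x', Suc d, True, e)))" .
      moreover have "m1 ((x, d, True, p), (x', Suc d, True, e)) = z x p" using True x(1) by (simp add: m1_def)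
      moreover have "y x' e = z x p" unfolding y_def pq x_def using True by simp
      ultimately show ?thesis by simp
    next
      case False
      then have "y x' e = (\<lambda>_. False)" unfolding y_def pq by auto
      then show ?thesis by simp
    qed
  qed
  obtain G1 where G1: "length G1 = t" "transcript arcs S ((F @ [m1]) @ G1)"
    "\<And>x i. x < N \<Longrightarrow> 1 \<le> i \<Longrightarrow> i \<le> width c (Suc d) \<Longrightarrow>
       knows arcs S ((F @ [m1]) @ G1) (x, Suc d, False, i) (y x i)"
    using deliversD[OF IH F1, of y] y_known by blast
  define m2 :: "tower_vertex \<times> tower_vertex \<Rightarrow> (nat \<Rightarrow> bool) \<Rightarrow> bool" where
    "m2 = (\<lambda>((x, d', b, i), v). if x < N \<and> d' = Suc d \<and> \<not> b \<and> 1 \<le> i \<and> i \<le> width c (Suc d) then y x i else (\<lambda>_. False))"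
  have "knows arcs S ((F @ [m1]) @ G1) u (m2 (u, v))" for u v
    using G1(3) by (cases u) (auto simp: m2_def)
  then have F2: "transcript arcs S (((F @ [m1]) @ G1) @ [m2])" using G1(2) by (intro transcript.snoc) auto
  have "knows arcs S (((F @ [m1]) @ G1) @ [m2]) (x, d, False, q) (z x p)"
    if *: "x < N" "p \<le> width c d" "q \<le> width c d" "p \<noteq> q" for x p q
  proof -
    let ?x' = "act x (prod_encode (d, slot p q))"
    have "((?x', Suc d, False, slot p q), (x, d, False, q)) \<in> arcs"
      using links.up[of x d p q False] * d by simp
    from knows_received[OF this, of S "(F @ [m1]) @ G1" m2] show ?thesis
      using * act_less[of x] act_act[of x] slot_pos[of p q] slot_le[OF c *(2,3)] by (simp add: m2_def y_def)
  qed
  then show ?thesis using F2 G1(1) that[of "[m1] @ G1 @ [m2]"] by simp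
qed

text \<open>Two crossings of \<open>t + 2\<close> rounds and one round on the bottleneck. First
  every \<open>t_q\<close> learns the symbols of all other sessions, so \<open>t_0\<close> can pass
  the parity to \<open>s_0\<close>; the second crossing spreads it, and \<open>t_j\<close> cancels
  the symbols it knows.\<close>

lemma delivers_step:
  assumes IH: "delivers (Suc d) t" and d: "d < h"
  shows "delivers d (2 * t + 5)"
  unfolding delivers_def
proof (intro allI impI)
  fix S F y
  assume F: "transcript arcs S F"
    and y: "\<forall>x<N. \<forall>i\<in>{1..width c d}. knows arcs S F (x, d, True, i) (y x i :: (nat \<Rightarrow> bool) \<Rightarrow> bool)"
  let ?I = "{1..width c d}"
  \<comment> \<open>The hub source has nothing to send yet.\<close>
  define z1 where "z1 x p = (if p = 0 then (\<lambda>_. False) else y x p)" for x p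
  have "knows arcs S F (x, d, True, p) (z1 x p)" if "x < N" "p \<le> width c d" for x p
    using y that by (auto simp: z1_def)
  then obtain G1 where G1: "length G1 = t + 2" "transcript arcs S (F @ G1)"
    "\<And>x p q. x < N \<Longrightarrow> p \<le> width c d \<Longrightarrow> q \<le> width c d \<Longrightarrow> p \<noteq> q \<Longrightarrow>
       knows arcs S (F @ G1) (x, d, False, q) (z1 x p)"
    using cross_virtual_edges[OF IH d F] by metis
  have side: "knows arcs S (F @ G1) (x, d, False, q) (y x p)"
    if "x < N" "p \<in> ?I" "q \<le> width c d" "p \<noteq> q" for x p q
    using G1(3)[of x p q] that by (auto simp: z1_def)
  have "knows arcs S (F @ G1) (x, d, False, 0) (parity ?I (y x))" if "x < N" for x
    by (rule knows_determined[of ?I _ _ _ _ "y x"]) (use side that in \<open>auto simp: parity_def cong: conj_cong\<close>)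
  moreover define m :: "tower_vertex \<times> tower_vertex \<Rightarrow> (nat \<Rightarrow> bool) \<Rightarrow> bool" where
    "m = (\<lambda>((x, d', b, i), v). if x < N \<and> d' = d \<and> \<not> b \<and> i = 0 then parity ?I (y x) else (\<lambda>_. False))"
  ultimately have "knows arcs S (F @ G1) u (m (u, v))" for u v
    by (cases u) (auto simp: m_def)
  then have F2: "transcript arcs S ((F @ G1) @ [m])" using G1(2) by (intro transcript.snoc) auto
  define z2 where "z2 x p = (if p = 0 then parity ?I (y x) else (\<lambda>_. False))" for x :: nat and p :: nat
  have "knows arcs S ((F @ G1) @ [m]) (x, d, True, p) (z2 x p)" if "x < N" "p \<le> width c d" for x p
  proof (cases "p = 0")
    case True
    have "((x, d, False, 0), (x, d, True, 0)) \<in> arcs" using necks.intros[of x d False] that d by simp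
    from knows_received[OF this, of S "F @ G1" m] show ?thesis using True that by (simp add: m_def z2_def)
  qed (simp add: z2_def)
  then obtain G2 where G2: "length G2 = t + 2" "transcript arcs S (((F @ G1) @ [m]) @ G2)"
    "\<And>x p q. x < N \<Longrightarrow> p \<le> width c d \<Longrightarrow> q \<le> width c d \<Longrightarrow> p \<noteq> q \<Longrightarrow>
       knows arcs S (((F @ G1) @ [m]) @ G2) (x, d, False, q) (z2 x p)"
    using cross_virtual_edges[OF IH d F2] by metis
  have "knows arcs S (((F @ G1) @ [m]) @ G2) (x, d, False, j) (y x j)" if "x < N" "j \<in> ?I" for x j
  \<comment> \<open>Index 0 does not occur in \<open>?I\<close> and stands for the parity.\<close>
  proof (rule knows_determined[of "insert 0 (?I - {j})" _ _ _ _ "\<lambda>i. if i = 0 then parity ?I (y x) else y x i"])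
    fix i assume "i \<in> insert 0 (?I - {j})"
    then show "knows arcs S (((F @ G1) @ [m]) @ G2) (x, d, False, j) (if i = 0 then parity ?I (y x) else y x i)"
    proof (cases "i = 0")
      case True
      then show ?thesis using G2(3)[of x 0 j] that by (simp add: z2_def)
    next
      case False
      then have "knows arcs S (F @ G1) (x, d, False, j) (y x i)"
        using side[of x i j] that \<open>i \<in> _\<close> by auto
      then have "knows arcs S (((F @ G1) @ [m]) @ G2) (x, d, False, j) (y x i)" by (rule knows_append[OF knows_append])
      then show ?thesis using False by simp
    qed
  next
    fix w w' assume *: "\<And>i. i \<in> insert 0 (?I - {j}) \<Longrightarrow>
      (if i = 0 then parity ?I (y x) else y x i) w = (if i = 0 then parity ?I (y x) else y x i) w'"
    show "y x j w = y x j w'"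
    proof (rule parity_cancel[of ?I j "y x"])
      show "parity ?I (y x) w = parity ?I (y x) w'" using *[of 0] by simp
      show "y x i w = y x i w'" if "i \<in> ?I" "i \<noteq> j" for i using *[of i] that by auto
    qed (use that in auto)
  qed
  then show "\<exists>G. length G = 2 * t + 5 \<and> transcript arcs S (F @ G) \<and>
        (\<forall>x<N. \<forall>i\<in>?I. knows arcs S (F @ G) (x, d, False, i) (y x i))"
    using G1(1) G2(1,2) by (intro exI[of _ "G1 @ [m] @ G2"]) auto
qed

text \<open>In the recursion \<open>2 * t + 5\<close> the quantity \<open>t + 5\<close> doubles per
  level, starting from 6 at the bottom.\<close>

lemma delivers_depth: "n \<le> h \<Longrightarrow> delivers (h - n) (6 * 2 ^ n - 5)"
proof (induction n)
  case 0
  then show ?case using delivers_bottom by simp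
next
  case (Suc n)
  have "delivers (Suc (h - Suc n)) (6 * 2 ^ n - 5)" using Suc by (simp add: Suc_diff_Suc)
  then have "delivers (h - Suc n) (2 * (6 * 2 ^ n - 5) + 5)" using Suc by (intro delivers_step) auto
  \<comment> \<open>Makes the truncated subtraction exact.\<close>
  moreover obtain k where "(2::nat) ^ n = Suc k" using not0_implies_Suc[of "2 ^ n"] by auto
  then have "2 * (6 * 2 ^ n - 5) + 5 = 6 * 2 ^ Suc n - (5::nat)" by simp
  ultimately show ?case by metis
qed

section \<open>The instance obtained from a tower\<close>

definition sources :: "tower_vertex list" where
  "sources = map (\<lambda>(x, i). (x, 0, True, i)) (List.product [0..<N] [1..<Suc (width c 0)])"

definition sinks :: "tower_vertex list" where
  "sinks = map (\<lambda>(x, i). (x, 0, False, i)) (List.product [0..<N] [1..<Suc (width c 0)])"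

text \<open>Counted in both directions there are at most \<open>N * h * 2\<close> bottleneck arcs
  against \<open>N * 2 ^ c\<close> sessions; \<open>big\<close> is the resulting condition that
  within \<open>3 ^ h\<close> rounds they serve at most half of them.\<close>

theorem tower_gap_instance:
  assumes big: "4 * h * 3 ^ h \<le> 2 ^ c"
  obtains M :: "nat unicast_instance" where "multiple_unicast M" "num_sessions M = N * 2 ^ c"
    "\<And>p. p \<ge> 1 \<Longrightarrow> coding_gap p M \<ge> 3 ^ h / (2 * (6 * 2 ^ h))"
proof -
  define V where "V = {..<N} \<times> {..h} \<times> (UNIV :: bool set) \<times> {..width c h}"
  have inV: "(x, d, b, i) \<in> V" if "x < N" "d \<le> h" "i \<le> width c d" for x d b i
    using that order_trans[OF that(3) width_mono[OF that(2)]] by (simp add: V_def)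
  have w0: "width c 0 = 2 ^ c" by (simp add: width_def)
  have sess: "\<exists>x i. x < N \<and> 1 \<le> i \<and> i \<le> width c 0 \<and> sources ! s = (x, 0, True, i) \<and> sinks ! s = (x, 0, False, i)"
    if "s < N * 2 ^ c" for s
  proof -
    obtain x i where xi: "List.product [0..<N] [1..<Suc (width c 0)] ! s = (x, i)" by fastforce
    have "s < length (List.product [0..<N] [1..<Suc (width c 0)])" using that by (simp add: w0)
    then have "(x, i) \<in> set (List.product [0..<N] [1..<Suc (width c 0)])"
      using xi nth_mem by metis
    then show ?thesis using xi that by (auto simp: sources_def sinks_def w0)
  qed
  have len: "length sources = N * 2 ^ c" "length sinks = N * 2 ^ c" by (auto simp: sources_def sinks_def w0)
  obtain F where F: "length F = 6 * 2 ^ h - 5" "transcript arcs sources F"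
    "\<And>s. s < N * 2 ^ c \<Longrightarrow> knows arcs sources F (sinks ! s) (\<lambda>x. x s)"
  proof -
    \<comment> \<open>The bit of the session starting at this terminal; the choice is determined
      since \<open>sources\<close> is distinct.\<close>
    define y where "y x i = (\<lambda>w::nat \<Rightarrow> bool. w (SOME s. s < N * 2 ^ c \<and> sources ! s = (x, 0, True, i)))" for x i
    have inj: "s = s'" if "s < N * 2 ^ c" "s' < N * 2 ^ c" "sources ! s = sources ! s'" for s s'
    proof -
      have "distinct sources" unfolding sources_def
        by (subst distinct_map) (auto simp: distinct_product inj_on_def)
      then show ?thesis using that len by (simp add: nth_eq_iff_index_eq)
    qed
    have ex: "\<exists>s. s < N * 2 ^ c \<and> sources ! s = (x, 0, True, i)" if "x < N" "1 \<le> i" "i \<le> width c 0" for x i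
    proof -
      have "(x, 0, True, i) \<in> set sources" using that by (force simp: sources_def)
      then show ?thesis by (metis in_set_conv_nth len(1))
    qed
    have "delivers 0 (6 * 2 ^ h - 5)" using delivers_depth[of h] by simp
    moreover have "knows arcs sources [] (x, 0, True, i) (y x i)" if "x < N" "1 \<le> i" "i \<le> width c 0" for x i
      using someI_ex[OF ex[OF that]] len unfolding y_def by (intro knows_source) auto
    ultimately obtain G where G: "length G = 6 * 2 ^ h - 5" "transcript arcs sources ([] @ G)"
      "\<And>x i. x < N \<Longrightarrow> 1 \<le> i \<Longrightarrow> i \<le> width c 0 \<Longrightarrow> knows arcs sources ([] @ G) (x, 0, False, i) (y x i)"
      using deliversD[OF _ transcript.Nil, of 0] by blast
    have "knows arcs sources G (sinks ! s) (\<lambda>x. x s)" if s: "s < N * 2 ^ c" for s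
    proof -
      obtain x i where xi: "x < N" "1 \<le> i" "i \<le> width c 0" "sources ! s = (x, 0, True, i)" "sinks ! s = (x, 0, False, i)"
        using sess[OF s] by blast
      have "(SOME s. s < N * 2 ^ c \<and> sources ! s = (x, 0, True, i)) = s"
        by (rule some_equality) (use inj s xi(4) in auto)
      then show ?thesis using G(3)[OF xi(1-3)] xi(5) by (simp add: y_def)
    qed
    then show ?thesis using G that by simp
  qed
  have necks_sub: "necks \<subseteq> (\<lambda>(x, d, b). ((x, d, b, 0), (x, d, \<not> b, 0))) ` ({..<N} \<times> {..<h} \<times> UNIV)"
    by (auto elim!: necks.cases simp: image_iff Bex_def)
  have "card necks \<le> card ({..<N} \<times> {..<h} \<times> (UNIV :: bool set))"
    by (rule surj_card_le[OF _ necks_sub]) auto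
  also have "\<dots> = N * h * 2" by (simp add: card_cartesian_product)
  finally have "2 * 3 ^ h * card necks \<le> 2 * 3 ^ h * (N * h * 2)" by simp
  also have "\<dots> = N * (4 * h * 3 ^ h)" by simp
  also have "\<dots> \<le> N * 2 ^ c" using big by (intro mult_left_mono) auto
  finally have card: "2 * 3 ^ h * card necks \<le> N * 2 ^ c" .
  have pow: "(1::nat) \<le> 2 ^ h" by simp
  obtain M :: "nat unicast_instance" where M: "multiple_unicast M" "num_sessions M = N * 2 ^ c"
    "\<And>p. p \<ge> 1 \<Longrightarrow> coding_gap p M \<ge> real (3 ^ h) / (2 * real (6 * 2 ^ h - 5))"
  proof (rule core_instance[of V arcs sources sinks "N * 2 ^ c" F "6 * 2 ^ h - 5" "3 ^ h" necks])
    show "finite V" by (simp add: V_def)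
    show "arcs \<subseteq> V \<times> V"
    proof (rule subrelI)
      fix u v assume *: "(u, v) \<in> arcs"
      obtain x d b i x' d' b' i' where uv: "u = (x, d, b, i)" "v = (x', d', b', i')" by (metis surj_pair)
      from *[unfolded uv] show "(u, v) \<in> V \<times> V" unfolding uv
        by (cases rule: arcs_cases) (auto intro!: inV act_less slot_le[OF c])
    qed
    show "sym arcs"
    proof (rule symI)
      fix u v assume *: "(u, v) \<in> arcs"
      obtain x d b i x' d' b' i' where uv: "u = (x, d, b, i)" "v = (x', d', b', i')" by (metis surj_pair)
      from *[unfolded uv] show "(v, u) \<in> arcs" unfolding uv
      proof (cases rule: arcs_cases)
        case bottom
        then show "((x', d', b', i'), (x, d, b, i)) \<in> arcs" using links.bottom[of x i b'] by simp
      next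
        case (down p q)
        then show "((x', d', b', i'), (x, d, b, i)) \<in> arcs" using links.up[of x d p q b] by simp
      next
        case (up p q)
        then show "((x', d', b', i'), (x, d, b, i)) \<in> arcs" using links.down[of x' d' p q b] by simp
      next
        case neck
        then show "((x', d', b', i'), (x, d, b, i)) \<in> arcs" using necks.intros[of x d b'] by simp
      qed
    qed
    show "irrefl arcs"
    proof (rule irreflI)
      fix u show "(u, u) \<notin> arcs"
      proof
        assume *: "(u, u) \<in> arcs"
        obtain x d b i where u: "u = (x, d, b, i)" by (metis surj_pair)
        from *[unfolded u] show False by (cases rule: arcs_cases) auto
      qed
    qed
    show "set sources \<subseteq> V" "set sinks \<subseteq> V" by (auto simp: sources_def sinks_def intro!: inV)
    show "sources ! s \<noteq> sinks ! s" if "s < N * 2 ^ c" for s using sess[OF that] by auto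
    show "1 \<le> N * 2 ^ c" using N_pos by (simp add: Suc_le_eq)
    show "1 \<le> 6 * 2 ^ h - (5::nat)" using pow by linarith
    show "(sources ! s, sinks ! s) \<notin> (arcs - necks) ^^ n" if s: "s < N * 2 ^ c" and n: "n < 3 ^ h" for s n
    proof
      assume *: "(sources ! s, sinks ! s) \<in> (arcs - necks) ^^ n"
      obtain x i where xi: "x < N" "sources ! s = (x, 0, True, i)" "sinks ! s = (x, 0, False, i)"
        using sess[OF s] by blast
      have "(arcs - necks) ^^ n \<subseteq> links ^^ n" by (induction n) auto
      then show False using links_distance[of x i n] * xi n by auto
    qed
  qed (use len F card in auto)
  have "(3::real) ^ h / (2 * (6 * 2 ^ h)) \<le> real (3 ^ h) / (2 * real (6 * 2 ^ h - 5))"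
  proof -
    have "real (6 * 2 ^ h - 5) \<le> real (6 * 2 ^ h)" unfolding of_nat_le_iff by simp
    then have le: "2 * real (6 * 2 ^ h - 5) \<le> 2 * (6 * 2 ^ h)" by simp
    have "0 < real (6 * 2 ^ h - 5)" unfolding of_nat_0_less_iff using pow by linarith
    then have pos: "0 < 2 * real (6 * 2 ^ h - 5)" by linarith
    show ?thesis by (rule frac_le[OF _ _ pos le]) simp_all
  qed
  then show ?thesis using M that by (meson order_trans)
qed

end

section \<open>The coding gap\<close>

text \<open>Colours up to \<open>2 ^ a\<close> and girth bound \<open>3 ^ h\<close> give an exponent
  of two of order \<open>2 ^ h * 4 ^ h * 3 ^ h\<close>, whence the base 24.\<close>

lemma ln_session_count_le:
  fixes N c h :: nat
  defines "a \<equiv> c * 4 ^ Suc h"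
  assumes c_le: "c \<le> 5 * 2 ^ h"
    and N: "N > 0" "N \<le> ((2 * 2 ^ a + 1) ^ (2 * 3 ^ h) + 1) ^ 4"
  shows "ln (real (N * 2 ^ c)) \<le> 185 * 24 ^ h"
proof -
  define E where "E = ((a + 2) * (2 * 3 ^ h) + 1) * 4 + c"
  have "(2 * 2 ^ a + 1 :: nat) \<le> 2 ^ (a + 2)" by (simp add: power_add)
  then have "(2 * 2 ^ a + 1 :: nat) ^ (2 * 3 ^ h) \<le> 2 ^ ((a + 2) * (2 * 3 ^ h))"
    unfolding power_mult[of 2 "a + 2"] by (rule power_mono) simp
  moreover have "(1::nat) \<le> 2 ^ ((a + 2) * (2 * 3 ^ h))" by simp
  ultimately have "(2 * 2 ^ a + 1 :: nat) ^ (2 * 3 ^ h) + 1 \<le> 2 ^ ((a + 2) * (2 * 3 ^ h) + 1)"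
    unfolding power_add power_one_right by linarith
  then have "((2 * 2 ^ a + 1 :: nat) ^ (2 * 3 ^ h) + 1) ^ 4 \<le> (2 ^ ((a + 2) * (2 * 3 ^ h) + 1)) ^ 4"
    by (rule power_mono) simp
  then have "N \<le> 2 ^ (((a + 2) * (2 * 3 ^ h) + 1) * 4)"
    unfolding power_mult[of 2 "(a + 2) * (2 * 3 ^ h) + 1"] using N(2) by (rule order_trans[rotated])
  then have "N * 2 ^ c \<le> 2 ^ E" unfolding E_def power_add[of 2 _ c] by (rule mult_right_mono) simp
  then have "real (N * 2 ^ c) \<le> real (2 ^ E)" by (rule of_nat_mono)
  moreover have "real (N * 2 ^ c) > 0" using N(1) by simp
  ultimately have "ln (real (N * 2 ^ c)) \<le> ln (real (2 ^ E))" by simp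
  also have "\<dots> = real E * ln 2" by (simp add: ln_realpow)
  also have "\<dots> \<le> real E * 1" using ln_2_less_1 by (intro mult_left_mono) auto
  also have "\<dots> \<le> 185 * 24 ^ h"
  proof -
    have "E \<le> ((5 * 2 ^ h * 4 ^ Suc h + 2) * (2 * 3 ^ h) + 1) * 4 + 5 * 2 ^ h"
      unfolding E_def a_def using c_le by (intro add_mono mult_mono) auto
    also have "\<dots> = 160 * 24 ^ h + 16 * 3 ^ h + 5 * 2 ^ h + 4"
    proof -
      have "(24::nat) ^ h = 2 ^ h * 4 ^ h * 3 ^ h" by (simp flip: power_mult_distrib)
      then show ?thesis by (simp add: algebra_simps)
    qed
    also have "\<dots> \<le> 160 * 24 ^ h + 16 * 24 ^ h + 5 * 24 ^ h + 4 * 24 ^ h"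
      by (intro add_mono mult_left_mono power_mono) auto
    finally have "E \<le> 185 * 24 ^ h" by simp
    then have "real E \<le> real (185 * 24 ^ h)" by (rule of_nat_mono)
    then show ?thesis by simp
  qed
  finally show ?thesis .
qed

lemma gap_instance:
  fixes h :: nat
  obtains M :: "nat unicast_instance" where "multiple_unicast M" "h \<le> num_sessions M"
    "ln (real (num_sessions M)) \<le> 185 * 24 ^ h"
    "\<And>p. p \<ge> 1 \<Longrightarrow> coding_gap p M \<ge> (3 / 2) ^ h / 12"
proof -
  \<comment> \<open>Then \<open>2 ^ c\<close> equals \<open>4 * 2 ^ h * 4 ^ h\<close>, which is at
    least \<open>4 * h * 3 ^ h\<close>.\<close>
  define c where "c = 3 * h + 2"
  \<comment> \<open>\<open>2 ^ a\<close> is \<open>width c (Suc h)\<close>, which will bound all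
    colours.\<close>
  define a where "a = c * 4 ^ Suc h"
  have h_less: "h \<le> 2 ^ h" by (rule less_imp_le[OF less_exp])
  have c_le: "c \<le> 5 * 2 ^ h"
  proof -
    have "(1::nat) \<le> 2 ^ h" by simp
    then show ?thesis unfolding c_def using h_less by linarith
  qed
  obtain N :: nat and act :: "nat \<Rightarrow> nat \<Rightarrow> nat" where N: "N > 0" "N \<le> ((2 * 2 ^ a + 1) ^ (2 * 3 ^ h) + 1) ^ 4"
    and act: "\<And>x l. x < N \<Longrightarrow> act x l < N" "\<And>x l. x < N \<Longrightarrow> act (act x l) l = x"
      "\<And>x ls. x < N \<Longrightarrow> ls \<noteq> [] \<Longrightarrow> length ls \<le> 3 ^ h \<Longrightarrow> distinct_adj ls \<Longrightarrow>
         \<forall>l\<in>set ls. l \<le> 2 ^ a \<Longrightarrow> foldl act x ls \<noteq> x"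
    by (rule high_girth_involutions[of "2 ^ a" "3 ^ h"]) (rule that)
  interpret tower h c "2 ^ a" N act
  proof
    show "prod_encode (d, e) \<le> 2 ^ a" if "d < h" "e \<le> width c h" for d e
    proof -
      have "c * 1 \<le> c * 4 ^ h" by (rule mult_le_mono2) simp
      moreover have "h \<le> c" by (simp add: c_def)
      ultimately have "h \<le> c * 4 ^ h" by linarith
      then have "2 ^ h \<le> width c h" unfolding width_def by (intro power_increasing) auto
      then have "d \<le> width c h" using that h_less by linarith
      \<comment> \<open>A colour pairs a depth with an index, both at most \<open>width c h\<close>,
        so it is bounded like a slot.\<close>
      then have "slot d e \<le> width c (Suc h)" using that by (intro slot_le) (auto simp: c_def)
      then show ?thesis by (simp add: slot_def width_def a_def)
    qed
  qed (use N act in \<open>auto simp: c_def\<close>)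
  have "4 * h * 3 ^ h \<le> 2 ^ c"
  proof -
    have "4 * h * 3 ^ h \<le> 4 * 2 ^ h * 4 ^ h" using h_less by (intro mult_mono power_mono) auto
    also have "\<dots> = 2 ^ (2 + h + 2 * h)" by (simp only: power_add power_mult) simp
    also have "2 + h + 2 * h = c" by (simp add: c_def)
    finally show ?thesis .
  qed
  then obtain M :: "nat unicast_instance" where M: "multiple_unicast M" "num_sessions M = N * 2 ^ c"
    "\<And>p. p \<ge> 1 \<Longrightarrow> coding_gap p M \<ge> 3 ^ h / (2 * (6 * 2 ^ h))"
    by (rule tower_gap_instance) (rule that)
  show ?thesis
  proof (rule that[OF M(1)])
    have "h \<le> 2 ^ c" using order_trans[OF h_less power_increasing[of h c "2::nat"]] by (simp add: c_def)
    also have "\<dots> \<le> N * 2 ^ c" using N(1) by simp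
    finally show "h \<le> num_sessions M" using M(2) by simp
    show "coding_gap p M \<ge> (3 / 2) ^ h / 12" if "p \<ge> 1" for p
      using M(3)[OF that] by (simp add: power_divide)
    show "ln (real (num_sessions M)) \<le> 185 * 24 ^ h"
      unfolding M(2) using c_le N unfolding a_def by (rule ln_session_count_le)
  qed
qed

theorem theorem4p4:
  shows "\<exists>c::real. c > 0 \<and>
    (\<exists>M :: nat \<Rightarrow> nat unicast_instance.
       (\<forall>n. multiple_unicast (M n)) \<and>
       filterlim (\<lambda>n. num_sessions (M n)) at_top sequentially \<and>
       (\<forall>p::ereal. p \<ge> 1 \<longrightarrow>
          (\<lambda>n. coding_gap p (M n)) \<in> \<Omega>(\<lambda>n. ln (real (num_sessions (M n))) powr c)))"
proof -
  have "\<forall>n. \<exists>M :: nat unicast_instance. multiple_unicast M \<and> n \<le> num_sessions M \<and>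
      ln (real (num_sessions M)) \<le> 185 * 24 ^ n \<and> (\<forall>p\<ge>1. coding_gap p M \<ge> (3 / 2) ^ n / 12)"
    by (metis gap_instance)
  then obtain M :: "nat \<Rightarrow> nat unicast_instance" where M: "\<And>n. multiple_unicast (M n)"
    "\<And>n. n \<le> num_sessions (M n)" "\<And>n. ln (real (num_sessions (M n))) \<le> 185 * 24 ^ n"
    "\<And>n p. p \<ge> 1 \<Longrightarrow> coding_gap p (M n) \<ge> (3 / 2) ^ n / 12"
    by metis
  have lim: "filterlim (\<lambda>n. num_sessions (M n)) at_top sequentially"
    by (rule filterlim_at_top_mono[OF filterlim_ident]) (simp add: M(2))
  \<comment> \<open>The exponent 1/10 works because \<open>24 \<le> (3 / 2) ^ 10\<close>;
    \<open>C\<close> absorbs the constant 185.\<close>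
  define C :: real where "C = 185 powr (1 / 10)"
  have C: "C > 0" by (simp add: C_def)
  have le: "ln (real (num_sessions (M n))) powr (1 / 10) \<le> C * (3 / 2) ^ n" for n
  proof -
    have pos: "0 \<le> ln (real (num_sessions (M n)))"
      using M(1)[of n] by (auto simp: multiple_unicast_def)
    define X :: real where "X = (3 / 2) ^ n"
    have X: "X > 0" by (simp add: X_def)
    have "(24::real) ^ n \<le> ((3 / 2) ^ 10) ^ n" by (rule power_mono) (simp_all add: power_divide)
    also have "\<dots> = X ^ 10" unfolding X_def by (simp only: power_mult[symmetric] mult.commute)
    finally have "ln (real (num_sessions (M n))) \<le> 185 * X ^ 10"
      using M(3)[of n] by linarith
    then have "ln (real (num_sessions (M n))) powr (1 / 10) \<le> (185 * X ^ 10) powr (1 / 10)"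
      using pos by (intro powr_mono2) auto
    also have "X ^ 10 = X powr 10" using X by (simp add: powr_numeral)
    also have "(185 * X powr 10) powr (1 / 10) = C * (X powr 10) powr (1 / 10)" by (simp add: C_def powr_mult)
    also have "(X powr 10) powr (1 / 10) = X" using X by (subst powr_powr) simp
    finally show ?thesis unfolding X_def .
  qed
  have "(\<lambda>n. coding_gap p (M n)) \<in> \<Omega>(\<lambda>n. ln (real (num_sessions (M n))) powr (1 / 10))" if "p \<ge> 1" for p
  \<comment> \<open>The 12 is the loss in the gap bound and \<open>C\<close> that in
    \<open>le\<close>; neither depends on \<open>p\<close>.\<close>
  proof (rule landau_omega.bigI[of "1 / (12 * C)"])
    have "1 / (12 * C) * norm (ln (real (num_sessions (M n))) powr (1 / 10)) \<le> norm (coding_gap p (M n))" for n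
    proof -
      have "1 / (12 * C) * norm (ln (real (num_sessions (M n))) powr (1 / 10)) \<le> 1 / (12 * C) * (C * (3 / 2) ^ n)"
        using le[of n] C by (intro mult_left_mono) auto
      also have "\<dots> = (3 / 2) ^ n / 12" using C by simp
      also have "\<dots> \<le> norm (coding_gap p (M n))" using M(4)[OF that, of n] by simp
      finally show ?thesis .
    qed
    then show "\<forall>\<^sub>F n in sequentially. 1 / (12 * C) * norm (ln (real (num_sessions (M n))) powr (1 / 10))
        \<le> norm (coding_gap p (M n))" by simp
  qed (use C in simp)
  then show ?thesis using M(1) lim by (intro exI[of _ "1 / 10"] conjI exI[of _ M]) auto
qed

end
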